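(* Let $G$ be a finite regular partial cube that is not isomorphic to $K_1$ or $K_2$, and let $n\geqslant 4$ be an integer. Then every convex cycle of $G$ is a $2n$-cycle if and only if $G$ is isomorphic to the cycle $C_{2n}$.
   Context: All graphs are finite, simple and undirected. A subgraph $H$ of $G$ is isometric if $d_H(u,v)=d_G(u,v)$ for all $u,v\in V(H)$, and convex if moreover every shortest $u,v$-path in $G$ (for $u,v\in V(H)$) lies in $H$. A partial cube is a graph isomorphic to an isometric subgraph of some hypercube $Q_n$. A convex cycle is a cycle that is a convex subgraph; an $l$-cycle is a cycle with $l$ edges. *)

theory Defs
  imports Main "HOL-Library.Extended_Nat"
begin

type_synonym 'a graph = "'a set \<times> 'a set set"

definition verts :: "'a graph \<Rightarrow> 'a set" where "verts G = fst G"
definition edges :: "'a graph \<Rightarrow> 'a set set" where "edges G = snd G"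

definition sgraph :: "'a graph \<Rightarrow> bool" where
  "sgraph G \<longleftrightarrow> (\<forall>e\<in>edges G. \<exists>u v. u \<in> verts G \<and> v \<in> verts G \<and> u \<noteq> v \<and> e = {u, v})"

definition adj :: "'a graph \<Rightarrow> 'a \<Rightarrow> 'a \<Rightarrow> bool" where
  "adj G u v \<longleftrightarrow> {u, v} \<in> edges G"

definition walk :: "'a graph \<Rightarrow> 'a list \<Rightarrow> bool" where
  "walk G xs \<longleftrightarrow> xs \<noteq> [] \<and> set xs \<subseteq> verts G \<and>
     (\<forall>i. i + 1 < length xs \<longrightarrow> adj G (xs ! i) (xs ! (i + 1)))"

text \<open>Graph distance (infinite if no walk exists).\<close>
definition dist :: "'a graph \<Rightarrow> 'a \<Rightarrow> 'a \<Rightarrow> enat" where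
  "dist G u v = (INF xs \<in> {xs. walk G xs \<and> hd xs = u \<and> last xs = v}. enat (length xs - 1))"

definition subgraph :: "'a graph \<Rightarrow> 'a graph \<Rightarrow> bool" where
  "subgraph H G \<longleftrightarrow> sgraph H \<and> verts H \<subseteq> verts G \<and> edges H \<subseteq> edges G"

definition isometric_subgraph :: "'a graph \<Rightarrow> 'a graph \<Rightarrow> bool" where
  "isometric_subgraph H G \<longleftrightarrow> subgraph H G \<and>
     (\<forall>u\<in>verts H. \<forall>v\<in>verts H. dist H u v = dist G u v)"

definition convex_subgraph :: "'a graph \<Rightarrow> 'a graph \<Rightarrow> bool" where
  "convex_subgraph H G \<longleftrightarrow> isometric_subgraph H G \<and>
     (\<forall>u\<in>verts H. \<forall>v\<in>verts H. \<forall>xs. walk G xs \<and> hd xs = u \<and> last xs = v \<and>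
        enat (length xs - 1) = dist G u v \<longrightarrow>
        set xs \<subseteq> verts H \<and> (\<forall>i. i + 1 < length xs \<longrightarrow> {xs ! i, xs ! (i + 1)} \<in> edges H))"

definition is_l_cycle :: "'a graph \<Rightarrow> nat \<Rightarrow> bool" where
  "is_l_cycle H l \<longleftrightarrow> (\<exists>xs. length xs = l \<and> l \<ge> 3 \<and> distinct xs \<and> verts H = set xs \<and>
     edges H = {{xs ! i, xs ! ((i + 1) mod l)} | i. i < l})"

definition is_cycle :: "'a graph \<Rightarrow> bool" where
  "is_cycle H \<longleftrightarrow> (\<exists>l. is_l_cycle H l)"

definition convex_cycle :: "'a graph \<Rightarrow> 'a graph \<Rightarrow> bool" where
  "convex_cycle H G \<longleftrightarrow> is_cycle H \<and> convex_subgraph H G"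

definition regular :: "'a graph \<Rightarrow> bool" where
  "regular G \<longleftrightarrow> (\<exists>k. \<forall>v\<in>verts G. card {u \<in> verts G. adj G v u} = k)"

definition isomorphic :: "'a graph \<Rightarrow> 'b graph \<Rightarrow> bool" where
  "isomorphic G H \<longleftrightarrow> (\<exists>f. bij_betw f (verts G) (verts H) \<and>
     (\<forall>u\<in>verts G. \<forall>v\<in>verts G. adj G u v \<longleftrightarrow> adj H (f u) (f v)))"

definition hypercube :: "nat \<Rightarrow> nat set graph" where
  "hypercube n = (Pow {0..<n},
     {{A, B} | A B. A \<subseteq> {0..<n} \<and> B \<subseteq> {0..<n} \<and> card ((A - B) \<union> (B - A)) = 1})"

definition partial_cube :: "'a graph \<Rightarrow> bool" where
  "partial_cube G \<longleftrightarrow> (\<exists>n H. isometric_subgraph H (hypercube n) \<and> isomorphic G H)"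

definition complete_graph :: "nat \<Rightarrow> nat graph" where
  "complete_graph k = ({0..<k}, {{i, j} | i j. i < k \<and> j < k \<and> i \<noteq> j})"

definition cycle_graph :: "nat \<Rightarrow> nat graph" where
  "cycle_graph k = ({0..<k}, {{i, (i + 1) mod k} | i. i < k})"

end

theory Submission
  imports Defs
begin

text \<open>
  Embed \<open>G\<close> isometrically in a hypercube. If two edges of the same class have no third edge of that
  class between them, then the interval they span is a convex cycle; so all distances between
  endpoints of a class on one side of it are multiples of \<open>n - 1\<close>. As \<open>n \<ge> 4\<close>, two
  convex cycles cannot share a path with two edges. On the other hand, the neighbours of a vertex
  \<open>x\<close> that are closer to a fixed vertex \<open>z\<close> are linked by convex cycles on which \<open>x\<close> is the vertex
  farthest from \<open>z\<close>. Three such neighbours would give two of these cycles sharing an edge, hence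
  parting at the next vertex, where they enclose a further cycle, and so on for ever in the direction
  of \<open>z\<close>. Hence a vertex farthest from \<open>z\<close> has degree at most 2. If the degree is 2, one such cycle
  exists and exhausts \<open>G\<close>.
\<close>

text \<open>In the cube, distance is the size of a symmetric difference, the interval from
  \<open>A\<close> to \<open>B\<close> is the condition
  \<open>A \<oplus> W \<subseteq> A \<oplus> B\<close>, and a class of edges is one coordinate
  \<open>s\<close>, whose edges join \<open>A\<close> and \<open>A \<oplus> {s}\<close>.

  The number \<open>n - 1\<close> arises because a convex \<open>2 * n\<close>-cycle flips each of
  its \<open>n\<close> coordinates on two opposite edges: on one side of class \<open>s\<close>, the
  ends of its two edges of that class differ in the other \<open>n - 1\<close> coordinates.

  The bound \<open>n \<ge> 4\<close> is needed for one arithmetical fact, that \<open>n - 1\<close>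
  does not divide 2. If two cycles share a path of two edges, the antipodes of its middle vertex are
  less than \<open>2 * (n - 1)\<close> apart and both meet the two classes of the path. Were they
  distinct, some third class would have two edges whose ends are at distance 2. So the antipodes
  agree, which leaves the cycles no room to differ.

  Regularity carries the degree of the farthest vertex over to all vertices; hence no edge leaves
  the cycle found there, and connectedness makes it all of \<open>G\<close>.\<close>

section \<open>Symmetric difference as the metric of the cube\<close>

definition sdiff :: "'b set \<Rightarrow> 'b set \<Rightarrow> 'b set" (infixl "\<oplus>" 75) where
  "A \<oplus> B = (A - B) \<union> (B - A)"

lemma mem_sdiff [simp]: "i \<in> A \<oplus> B \<longleftrightarrow> (i \<in> A) \<noteq> (i \<in> B)"
  by (auto simp: sdiff_def)

lemma sdiff_commute: "A \<oplus> B = B \<oplus> A"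
  by auto

lemma sdiff_self [simp]: "A \<oplus> A = {}"
  by auto

lemma sdiff_empty [simp]: "A \<oplus> {} = A" "{} \<oplus> A = A"
  by auto

lemma sdiff_cancel [simp]: "A \<oplus> (A \<oplus> B) = B" "A \<oplus> B \<oplus> B = A"
  by auto

lemma sdiff_eq_empty_iff [simp]: "A \<oplus> B = {} \<longleftrightarrow> A = B"
  by (auto simp: sdiff_def)

lemma finite_sdiff [simp]: "finite A \<Longrightarrow> finite B \<Longrightarrow> finite (A \<oplus> B)"
  by (simp add: sdiff_def)

lemma sdiff_left_cancel [simp]: "A \<oplus> B = A \<oplus> C \<longleftrightarrow> B = C"
  by (metis sdiff_cancel(1))

text \<open>Flipping a coordinate in which \<open>A\<close> and \<open>B\<close> differ is a step
  towards \<open>B\<close>, any other flip a step away. As \<open>\<oplus>\<close> associates to the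
  left, \<open>A \<oplus> {i} \<oplus> B\<close> compares the flipped \<open>A\<close> with
  \<open>B\<close>.\<close>

lemma card_sdiff_flip:
  assumes "finite A" "finite B"
  shows "i \<in> A \<oplus> B \<Longrightarrow> Suc (card (A \<oplus> {i} \<oplus> B)) = card (A \<oplus> B)"
    and "i \<notin> A \<oplus> B \<Longrightarrow> card (A \<oplus> {i} \<oplus> B) = Suc (card (A \<oplus> B))"
proof -
  assume "i \<in> A \<oplus> B"
  moreover from this have "A \<oplus> {i} \<oplus> B = A \<oplus> B - {i}" by auto
  ultimately show "Suc (card (A \<oplus> {i} \<oplus> B)) = card (A \<oplus> B)"
    using assms by (metis card_Suc_Diff1 finite_sdiff)
next
  assume "i \<notin> A \<oplus> B"
  moreover from this have "A \<oplus> {i} \<oplus> B = insert i (A \<oplus> B)" by auto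
  ultimately show "card (A \<oplus> {i} \<oplus> B) = Suc (card (A \<oplus> B))"
    using assms by (metis card_insert_disjoint finite_sdiff)
qed

lemma card_sdiff_triangle:
  assumes "finite A" "finite B" "finite C"
  shows "card (A \<oplus> C) \<le> card (A \<oplus> B) + card (B \<oplus> C)"
proof -
  have "A \<oplus> C \<subseteq> (A \<oplus> B) \<union> (B \<oplus> C)" by auto
  then have "card (A \<oplus> C) \<le> card ((A \<oplus> B) \<union> (B \<oplus> C))"
    using assms by (intro card_mono) auto
  then show ?thesis using card_Un_le le_trans by blast
qed

lemma card_sdiff_between:
  assumes "finite A" "finite B" "finite C"
    and "card (A \<oplus> B) + card (B \<oplus> C) \<le> card (A \<oplus> C)"
  shows "A \<oplus> B \<subseteq> A \<oplus> C"
proof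
  fix i assume i: "i \<in> A \<oplus> B"
  show "i \<in> A \<oplus> C"
  proof (rule ccontr)
    assume n: "i \<notin> A \<oplus> C"
    then have "A \<oplus> C \<subseteq> (A \<oplus> B - {i}) \<union> (B \<oplus> C)" by auto
    then have "card (A \<oplus> C) \<le> card ((A \<oplus> B - {i}) \<union> (B \<oplus> C))"
      using assms by (intro card_mono) auto
    also have "\<dots> \<le> card (A \<oplus> B - {i}) + card (B \<oplus> C)" by (rule card_Un_le)
    also have "card (A \<oplus> B - {i}) < card (A \<oplus> B)"
      using i assms by (intro card_Diff1_less) simp_all
    finally show False using assms(4) by simp
  qed
qed

lemma card_sdiff_add:
  assumes "finite A" "finite C" "A \<oplus> B \<subseteq> A \<oplus> C"
  shows "card (A \<oplus> C) = card (A \<oplus> B) + card (B \<oplus> C)"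
proof -
  have eq: "A \<oplus> C = (A \<oplus> B) \<union> (B \<oplus> C)" "(A \<oplus> B) \<inter> (B \<oplus> C) = {}"
    using assms(3) by auto
  moreover have "finite (A \<oplus> C)" using assms by simp
  ultimately show ?thesis by (metis card_Un_disjoint finite_Un)
qed

section \<open>Isometric set families\<close>

text \<open>Isometry without walks: by \<open>step\<close>, some flip towards any other member stays
  in the family, so repeated flips reach it in as many steps as the cube needs.\<close>

locale isometric_family =
  fixes V :: "'b set set"
  assumes fin: "A \<in> V \<Longrightarrow> finite A"
    and step: "A \<in> V \<Longrightarrow> B \<in> V \<Longrightarrow> A \<noteq> B \<Longrightarrow> \<exists>i\<in>A \<oplus> B. A \<oplus> {i} \<in> V"
begin

text \<open>A geodesic from \<open>A\<close> to \<open>B\<close> flips \<open>i\<close> exactly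
  once; \<open>W\<close> is its vertex just before that flip.\<close>

lemma crossing:
  assumes "A \<in> V" "B \<in> V" "i \<in> A \<oplus> B"
  shows "\<exists>W\<in>V. A \<oplus> W \<subseteq> A \<oplus> B \<and> i \<notin> A \<oplus> W \<and> W \<oplus> {i} \<in> V"
  using assms
proof (induction "card (A \<oplus> B)" arbitrary: A rule: less_induct)
  case less
  then have "A \<noteq> B" by auto
  then obtain j where j: "j \<in> A \<oplus> B" "A \<oplus> {j} \<in> V" using step less.prems by blast
  show ?case
  proof (cases "j = i")
    case True
    then show ?thesis using j less.prems by (intro bexI[of _ A]) auto
  next
    case False
    have "card (A \<oplus> {j} \<oplus> B) < card (A \<oplus> B)"
      using card_sdiff_flip(1)[OF _ _ j(1)] fin less.prems by fastforce
    moreover have "i \<in> A \<oplus> {j} \<oplus> B" using False less.prems(3) by auto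
    ultimately obtain W where W: "W \<in> V" "A \<oplus> {j} \<oplus> W \<subseteq> A \<oplus> {j} \<oplus> B" "i \<notin> A \<oplus> {j} \<oplus> W"
      "W \<oplus> {i} \<in> V"
      using less.hyps j(2) less.prems(2) by blast
    have "A \<oplus> W \<subseteq> A \<oplus> B" using W(2) j(1) by (auto split: if_splits)
    moreover have "i \<notin> A \<oplus> W" using W(3) False by auto
    ultimately show ?thesis using W by blast
  qed
qed

lemma geodesic:
  assumes "A \<in> V" "B \<in> V"
  shows "\<exists>cs. distinct cs \<and> set cs = A \<oplus> B \<and> (\<forall>k. A \<oplus> set (take k cs) \<in> V)"
  using assms
proof (induction "card (A \<oplus> B)" arbitrary: A rule: less_induct)
  case less
  show ?case
  proof (cases "A = B")
    case True
    then show ?thesis using less.prems by (intro exI[of _ "[]"]) auto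
  next
    case False
    then obtain j where j: "j \<in> A \<oplus> B" "A \<oplus> {j} \<in> V" using step less.prems by blast
    have "card (A \<oplus> {j} \<oplus> B) < card (A \<oplus> B)"
      using card_sdiff_flip(1)[OF _ _ j(1)] fin less.prems by fastforce
    then obtain cs where cs: "distinct cs" "set cs = A \<oplus> {j} \<oplus> B"
      "\<And>k. A \<oplus> {j} \<oplus> set (take k cs) \<in> V"
      using less.hyps j(2) less.prems(2) by blast
    have jn: "j \<notin> set cs" using cs(2) j(1) by auto
    have "A \<oplus> set (take k (j # cs)) \<in> V" for k
    proof (cases k)
      case 0
      then show ?thesis using less.prems by simp
    next
      case (Suc k')
      have "j \<notin> set (take k' cs)" using jn by (meson in_set_takeD)
      then have "A \<oplus> set (take k (j # cs)) = A \<oplus> {j} \<oplus> set (take k' cs)"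
        unfolding Suc by auto
      then show ?thesis using cs(3) by simp
    qed
    moreover have "set (j # cs) = A \<oplus> B" using cs(2) j(1) by auto
    moreover have "distinct (j # cs)" using cs(1) jn by simp
    ultimately show ?thesis by blast
  qed
qed

text \<open>\<open>cyc P ds\<close>: the vertices of the subcube spanned by \<open>P\<close> and the coordinates \<open>ds\<close> form a
  cycle through \<open>P\<close>, and \<open>ds\<close> lists the coordinates in the order in which they are flipped from
  \<open>P\<close> to its antipode along one of the two sides.\<close>

definition cyc :: "'b set \<Rightarrow> 'b list \<Rightarrow> bool" where
  "cyc P ds \<longleftrightarrow> distinct ds \<and>
     (\<forall>k. P \<oplus> set (take k ds) \<in> V \<and> P \<oplus> set (drop k ds) \<in> V) \<and>
     (\<forall>Z\<in>V. P \<oplus> Z \<subseteq> set ds \<longrightarrow> (\<exists>k. P \<oplus> Z = set (take k ds) \<or> P \<oplus> Z = set (drop k ds)))"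

lemma cyc_take: "cyc P ds \<Longrightarrow> P \<oplus> set (take k ds) \<in> V"
  and cyc_drop: "cyc P ds \<Longrightarrow> P \<oplus> set (drop k ds) \<in> V"
  and cyc_distinct: "cyc P ds \<Longrightarrow> distinct ds"
  by (auto simp: cyc_def)

text \<open>Suffixes of \<open>ds\<close> are prefixes of its reversal, so the second side of the
  cycle flips the coordinates in reverse order. In particular \<open>hd ds\<close> and
  \<open>last ds\<close> are the classes of the two edges at \<open>P\<close>.\<close>

lemma cyc_rev:
  assumes "cyc P ds"
  shows "cyc P (rev ds)"
proof -
  have t: "set (take k (rev ds)) = set (drop (length ds - k) ds)"
    and d: "set (drop k (rev ds)) = set (take (length ds - k) ds)" for k
    by (simp_all add: take_rev drop_rev)
  have t': "set (take k ds) = set (drop (length ds - k) (rev ds))"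
    and d': "set (drop k ds) = set (take (length ds - k) (rev ds))" for k
    by (simp_all add: take_rev drop_rev) (cases "k \<le> length ds"; simp)+
  show ?thesis
    using assms unfolding cyc_def t d
    by (metis (no_types, lifting) d d' distinct_rev set_rev t t')
qed

text \<open>Adjacency in the zone graph of class \<open>s\<close>, whose vertices are the edges of
  that class. It is expressed by the absence of an edge in between; the common convex cycle is then
  derived.\<close>

definition zone_adjacent :: "'b \<Rightarrow> 'b set \<Rightarrow> 'b set \<Rightarrow> bool" where
  "zone_adjacent s P R \<longleftrightarrow> P \<in> V \<and> R \<in> V \<and> P \<noteq> R \<and> s \<notin> P \<oplus> R \<and> P \<oplus> {s} \<in> V \<and> R \<oplus> {s} \<in> V \<and>
     (\<forall>W\<in>V. P \<oplus> W \<subseteq> P \<oplus> R \<longrightarrow> W \<oplus> {s} \<in> V \<longrightarrow> W = P \<or> W = R)"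

text \<open>A geodesic from the side of \<open>P\<close> and \<open>R\<close> to the other side of the class \<open>s\<close> must cross it at
  \<open>P\<close> or at \<open>R\<close>; this forces the vertices of the two sides to be complementary, hence determined
  by their distance from \<open>P\<close>.\<close>

lemma zone_adjacent_cyc:
  assumes "zone_adjacent s P R"
  obtains cs where "set cs = P \<oplus> R" "cyc P (cs @ [s])"
    "\<And>Z. Z \<in> V \<Longrightarrow> P \<oplus> Z \<subseteq> P \<oplus> R \<Longrightarrow> P \<oplus> Z = set (take (card (P \<oplus> Z)) cs)"
proof -
  define T where "T = P \<oplus> R"
  have V: "P \<in> V" "R \<in> V" "P \<oplus> {s} \<in> V" "R \<oplus> {s} \<in> V" and sT: "s \<notin> T"
    and only: "\<And>W. W \<in> V \<Longrightarrow> P \<oplus> W \<subseteq> T \<Longrightarrow> W \<oplus> {s} \<in> V \<Longrightarrow> W = P \<or> W = R"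
    using assms unfolding zone_adjacent_def T_def by auto
  have finT: "finite T" using V fin T_def by simp
  \<comment> \<open>Crossing at \<open>P\<close> makes the two sets disjoint, crossing at
    \<open>R\<close> makes their union \<open>T\<close>.\<close>
  have compl: "(P \<oplus> Z) \<inter> Y = {} \<or> (P \<oplus> Z) \<union> Y = T"
    if Z: "Z \<in> V" "P \<oplus> Z \<subseteq> T" and Y: "P \<oplus> {s} \<oplus> Y \<in> V" "Y \<subseteq> T" for Z Y
  proof -
    have sP: "s \<notin> P \<oplus> Z" "s \<notin> Y" using Z Y sT by blast+
    then have "s \<in> Z \<oplus> (P \<oplus> {s} \<oplus> Y)" by auto
    then obtain W where W: "W \<in> V" "Z \<oplus> W \<subseteq> Z \<oplus> (P \<oplus> {s} \<oplus> Y)" "s \<notin> Z \<oplus> W" "W \<oplus> {s} \<in> V"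
      using crossing Z Y by blast
    have b: "P \<oplus> W \<subseteq> (P \<oplus> Z) \<union> Y" "(P \<oplus> Z) \<inter> Y \<subseteq> P \<oplus> W"
      using W(2,3) sP by (auto split: if_splits)
    then have "W = P \<or> W = R" using only W Z Y by blast
    then show ?thesis using b Z(2) Y(2) T_def by auto
  qed
  obtain cs where cs: "distinct cs" "set cs = T" "\<And>k. P \<oplus> set (take k cs) \<in> V"
    using geodesic[OF V(1,2)] T_def by auto
  obtain ys where ys: "distinct ys" "set ys = P \<oplus> {s} \<oplus> (R \<oplus> {s})"
      "\<And>k. P \<oplus> {s} \<oplus> set (take k ys) \<in> V"
    using geodesic[OF V(3,4)] by blast
  have "P \<oplus> {s} \<oplus> (R \<oplus> {s}) = T" using T_def by auto
  then have ysT: "set ys = T" using ys by simp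
  define d where "d = card T"
  have len: "length cs = d" "length ys = d"
    using cs ys ysT distinct_card d_def by metis+
  \<comment> \<open>When the sizes add up to that of \<open>T\<close>, disjointness and covering
    imply each other.\<close>
  have complE: "X = T - Y" if "(X \<inter> Y = {} \<or> X \<union> Y = T)" "X \<subseteq> T" "Y \<subseteq> T" "card X + card Y = d" for X Y
  proof -
    have fin': "finite X" "finite Y" using that finT finite_subset by auto
    have "card (X \<union> Y) + card (X \<inter> Y) = d" using that card_Un_Int[OF fin'] by simp
    then have "X \<inter> Y = {} \<and> X \<union> Y = T"
      using that(1) fin' finT d_def that(2,3)
      by (metis Un_least add.right_neutral add_left_cancel card_0_eq card_seteq card.empty finite_Int le_refl)
    then show ?thesis by blast
  qed
  \<comment> \<open>\<open>Z\<close> is compared with the vertex across \<open>s\<close> whose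
    distance from \<open>P \<oplus> {s}\<close> complements that of \<open>Z\<close> from
    \<open>P\<close>.\<close>
  have Zdet: "P \<oplus> Z = T - set (take (d - card (P \<oplus> Z)) ys)" if "Z \<in> V" "P \<oplus> Z \<subseteq> T" for Z
  proof (rule complE)
    show "P \<oplus> Z \<inter> set (take (d - card (P \<oplus> Z)) ys) = {} \<or> P \<oplus> Z \<union> set (take (d - card (P \<oplus> Z)) ys) = T"
      using compl[OF that ys(3)] set_take_subset[of "d - card (P \<oplus> Z)" ys] ysT by blast
    show "set (take (d - card (P \<oplus> Z)) ys) \<subseteq> T" using set_take_subset ysT by metis
    have "card (P \<oplus> Z) \<le> d" using that d_def card_mono finT by blast
    then show "card (P \<oplus> Z) + card (set (take (d - card (P \<oplus> Z)) ys)) = d"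
      using ys(1) len by (simp add: distinct_card)
  qed (use that in auto)
  have takesub: "set (take k cs) \<subseteq> T" for k using set_take_subset cs(2) by metis
  have cardtake: "card (set (take k cs)) = min k d" for k
    using cs(1) len by (simp add: distinct_card)
  \<comment> \<open>The prefix of \<open>cs\<close> of the same size has the same complement, so
    \<open>Z\<close> lies on the geodesic \<open>cs\<close>.\<close>
  have Zt: "P \<oplus> Z = set (take (card (P \<oplus> Z)) cs)" if Z: "Z \<in> V" "P \<oplus> Z \<subseteq> T" for Z
  proof -
    have le: "card (P \<oplus> Z) \<le> d" using Z d_def card_mono finT by blast
    have "set (take (card (P \<oplus> Z)) cs) = T - set (take (d - card (P \<oplus> Z)) ys)"
      using Zdet[OF cs(3)[of "card (P \<oplus> Z)"]] takesub cardtake le by (simp add: min_absorb1)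
    then show ?thesis using Zdet[OF Z] by simp
  qed
  have dropT: "T - set (take k cs) = set (drop k cs)" for k
  proof -
    have "set cs = set (take k cs) \<union> set (drop k cs)" by (metis append_take_drop_id set_append)
    then show ?thesis using cs(1,2) set_take_disj_set_drop_if_distinct[OF cs(1), of k k] by blast
  qed
  have Yt: "Y = set (drop (d - card Y) cs)" if Y: "P \<oplus> {s} \<oplus> Y \<in> V" "Y \<subseteq> T" for Y
  proof -
    have le: "card Y \<le> d" using Y d_def card_mono finT by blast
    have "Y = T - set (take (d - card Y) cs)"
    proof (rule complE)
      show "Y \<inter> set (take (d - card Y) cs) = {} \<or> Y \<union> set (take (d - card Y) cs) = T"
        using compl[OF cs(3)[of "d - card Y"] _ Y] takesub by (simp add: Int_commute Un_commute)
    qed (use Y takesub cardtake le in auto)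
    then show ?thesis using dropT by simp
  qed
  \<comment> \<open>Prefixes run along the side of \<open>P\<close> and cross \<open>s\<close> at
    \<open>R\<close>; nonempty suffixes contain \<open>s\<close>, so they have crossed at
    \<open>P\<close> already.\<close>
  have "cyc P (cs @ [s])"
    unfolding cyc_def
  proof (intro conjI allI ballI impI)
    show "distinct (cs @ [s])" using cs sT by auto
    fix k
    show "P \<oplus> set (take k (cs @ [s])) \<in> V"
    proof (cases "k \<le> d")
      case True
      then show ?thesis using cs(3) len by simp
    next
      case False
      then have "set (take k (cs @ [s])) = insert s T" using len cs by simp
      then have "P \<oplus> set (take k (cs @ [s])) = R \<oplus> {s}" using sT T_def by auto
      then show ?thesis using V by simp
    qed
    show "P \<oplus> set (drop k (cs @ [s])) \<in> V"
    proof (cases "k \<le> d")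
      case True
      have "set (take (d - k) ys) \<subseteq> T" using set_take_subset ysT by metis
      moreover have "card (set (take (d - k) ys)) = d - k"
        using ys(1) len by (simp add: distinct_card)
      ultimately have "set (take (d - k) ys) = set (drop k cs)"
        using Yt[OF ys(3)[of "d - k"]] True by simp
      moreover have "s \<notin> set (drop k cs)" using sT cs(2) by (meson in_set_dropD)
      ultimately have "P \<oplus> set (drop k (cs @ [s])) = P \<oplus> {s} \<oplus> set (take (d - k) ys)"
        using True len by auto
      then show ?thesis using ys(3) by simp
    next
      case False
      then show ?thesis using len V by simp
    qed
  next
    fix Z assume Z: "Z \<in> V" "P \<oplus> Z \<subseteq> set (cs @ [s])"
    show "\<exists>k. P \<oplus> Z = set (take k (cs @ [s])) \<or> P \<oplus> Z = set (drop k (cs @ [s]))"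
    proof (cases "s \<in> P \<oplus> Z")
      case False
      then have "P \<oplus> Z \<subseteq> T" using Z cs by auto
      moreover from this have "card (P \<oplus> Z) \<le> d" using d_def card_mono finT by blast
      ultimately show ?thesis using Zt[OF Z(1)] len by (intro exI[of _ "card (P \<oplus> Z)"]) simp
    next
      case True
      define Y where "Y = (P \<oplus> Z) - {s}"
      have "P \<oplus> {s} \<oplus> Y = Z" using True Y_def by auto
      moreover have "Y \<subseteq> T" using Z cs Y_def by auto
      ultimately have "Y = set (drop (d - card Y) cs)" using Yt Z by simp
      moreover have "P \<oplus> Z = insert s Y" using True Y_def by blast
      ultimately have "P \<oplus> Z = set (drop (d - card Y) (cs @ [s]))" using len by simp
      then show ?thesis by blast
    qed
  qed
  then show thesis using that cs(2) Zt unfolding T_def by blast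
qed

end

section \<open>Families in which all convex cycles have the same length\<close>

text \<open>Consecutive edges span a cycle on the coordinates \<open>P \<oplus> R\<close> and
  \<open>s\<close>, twice as long as their number; length \<open>2 * n\<close> leaves
  \<open>n - 1\<close> for \<open>P \<oplus> R\<close>.\<close>

locale equal_zones = isometric_family +
  fixes n :: nat
  assumes n4: "n \<ge> 4"
    and zone: "zone_adjacent s P R \<Longrightarrow> card (P \<oplus> R) = n - 1"
begin

text \<open>Any edge of class \<open>s\<close> in between splits the distance into a sum; the
  splitting ends with consecutive edges, each pair contributing \<open>n - 1\<close>.\<close>

lemma zone_dvd:
  assumes "P \<in> V" "R \<in> V" "s \<notin> P \<oplus> R" "P \<oplus> {s} \<in> V" "R \<oplus> {s} \<in> V"
  shows "(n - 1) dvd card (P \<oplus> R)"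
  using assms
proof (induction "card (P \<oplus> R)" arbitrary: P R rule: less_induct)
  case less
  show ?case
  proof (cases "P = R \<or> zone_adjacent s P R")
    case True
    then show ?thesis using zone by auto
  next
    case False
    then obtain W where W: "W \<in> V" "P \<oplus> W \<subseteq> P \<oplus> R" "W \<oplus> {s} \<in> V" "W \<noteq> P" "W \<noteq> R"
      using less.prems unfolding zone_adjacent_def by blast
    have fin': "finite P" "finite R" "finite W" using fin less.prems W by auto
    have add: "card (P \<oplus> R) = card (P \<oplus> W) + card (W \<oplus> R)"
      using card_sdiff_add W(2) fin' by blast
    have pos: "card (P \<oplus> W) > 0" "card (W \<oplus> R) > 0"
      using W fin' by (auto simp: card_gt_0_iff)
    have s: "s \<notin> P \<oplus> W" "s \<notin> W \<oplus> R" using W(2) less.prems(3) by auto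
    have "(n - 1) dvd card (P \<oplus> W)"
      using less.hyps[of P W] add pos s less.prems W by simp
    moreover have "(n - 1) dvd card (W \<oplus> R)"
      using less.hyps[of W R] add pos s less.prems W by simp
    ultimately show ?thesis using add by simp
  qed
qed

text \<open>If \<open>P \<noteq> R\<close>, then \<open>P\<close> and \<open>R\<close> are joined by the same path in the zones of \<open>s\<close> and of \<open>t\<close>. Its
  last class \<open>l\<close> is flippable at \<open>P \<oplus> {s}\<close> and at \<open>P \<oplus> {t}\<close>, which have distance 2.\<close>

lemma two_classes_eq:
  assumes V: "P \<in> V" "R \<in> V" "P \<oplus> {s} \<in> V" "R \<oplus> {s} \<in> V" "P \<oplus> {t} \<in> V" "R \<oplus> {t} \<in> V"
    and st: "s \<noteq> t" "s \<notin> P \<oplus> R" "t \<notin> P \<oplus> R"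
    and small: "card (P \<oplus> R) < 2 * (n - 1)"
  shows "P = R"
proof (rule ccontr)
  assume ne: "P \<noteq> R"
  have fin': "finite P" "finite R" using V fin by auto
  obtain q where q: "card (P \<oplus> R) = (n - 1) * q"
    using zone_dvd[OF V(1,2) st(2) V(3,4)] by (auto elim: dvdE)
  have "q \<noteq> 0" using q ne fin' by auto
  moreover have "q < 2"
  proof (rule ccontr)
    assume "\<not> q < 2"
    then have "(n - 1) * 2 \<le> (n - 1) * q" by simp
    then show False using q small by simp
  qed
  ultimately have "q = 1" by simp
  then have c: "card (P \<oplus> R) = n - 1" using q by simp
  \<comment> \<open>At distance exactly \<open>n - 1\<close> no third edge fits in between: its
    distance from \<open>P\<close> would be a smaller positive multiple of
    \<open>n - 1\<close>.\<close>
  have za: "zone_adjacent r P R" if r: "r \<notin> P \<oplus> R" "P \<oplus> {r} \<in> V" "R \<oplus> {r} \<in> V" for r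
  proof -
    have "W = P \<or> W = R" if W: "W \<in> V" "P \<oplus> W \<subseteq> P \<oplus> R" "W \<oplus> {r} \<in> V" for W
    proof (rule ccontr)
      assume n: "\<not> (W = P \<or> W = R)"
      have "finite W" using W fin by auto
      have "card (P \<oplus> R) = card (P \<oplus> W) + card (W \<oplus> R)"
        using card_sdiff_add W(2) fin' by blast
      moreover have "card (P \<oplus> W) > 0" "card (W \<oplus> R) > 0"
        using n fin' \<open>finite W\<close> by (auto simp: card_gt_0_iff)
      moreover have "r \<notin> P \<oplus> W" using W(2) r(1) by blast
      then have "(n - 1) dvd card (P \<oplus> W)"
        using zone_dvd[of P W r] V W r by blast
      ultimately show False using c by (auto dest: dvd_imp_le)
    qed
    then show ?thesis unfolding zone_adjacent_def using V ne r by blast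
  qed
  obtain cs where cs: "set cs = P \<oplus> R" "cyc P (cs @ [s])"
    "\<And>Z. Z \<in> V \<Longrightarrow> P \<oplus> Z \<subseteq> P \<oplus> R \<Longrightarrow> P \<oplus> Z = set (take (card (P \<oplus> Z)) cs)"
    using zone_adjacent_cyc[OF za[OF st(2) V(3,4)]] by blast
  obtain cs' where cs': "set cs' = P \<oplus> R" "cyc P (cs' @ [t])"
    by (rule zone_adjacent_cyc[OF za[OF st(3) V(5,6)]])
  have dist: "distinct cs" "distinct cs'" using cyc_distinct[OF cs(2)] cyc_distinct[OF cs'(2)] by auto
  have len: "length cs = n - 1" "length cs' = n - 1"
    using dist cs cs' c distinct_card by metis+
  have "cs \<noteq> []" "cs' \<noteq> []" using len n4 by auto
  then obtain as l as' l' where as: "cs = as @ [l]" "cs' = as' @ [l']" by (metis rev_exhaust)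
  have las: "length as = n - 2" "length as' = n - 2" using as len by auto
  \<comment> \<open>The last vertex before \<open>R\<close> on \<open>cs'\<close> lies in the
    interval, where vertices are determined by their distance from \<open>P\<close>; so it is also
    the last one before \<open>R\<close> on \<open>cs\<close>.\<close>
  have "P \<oplus> set as' \<in> V" using cyc_take[OF cs'(2), of "n - 2"] as las by simp
  moreover have "set as' \<subseteq> P \<oplus> R" using cs' as by auto
  moreover have "card (set as') = n - 2" using dist las as distinct_card by fastforce
  ultimately have "set as' = set as" using cs(3)[of "P \<oplus> set as'"] as las by simp
  then have "l = l'" using dist as cs(1) cs'(1) by auto
  \<comment> \<open>Seen from \<open>P\<close> through \<open>s\<close>, the cycle flips its list
    backwards: \<open>s\<close>, then \<open>l\<close>.\<close>
  have "P \<oplus> {l, s} \<in> V" using cyc_drop[OF cs(2), of "n - 2"] as las by simp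
  moreover have "P \<oplus> {l, t} \<in> V" using cyc_drop[OF cs'(2), of "n - 2"] as las \<open>l = l'\<close> by simp
  moreover have "l \<noteq> s" "l \<noteq> t" using cs(1) as st by auto
  moreover have "P \<oplus> {s} \<oplus> {l} = P \<oplus> {l, s}" "P \<oplus> {t} \<oplus> {l} = P \<oplus> {l, t}" using calculation by auto
  moreover have "P \<oplus> {s} \<oplus> (P \<oplus> {t}) = {s, t}" using st by auto
  ultimately have "(n - 1) dvd card {s, t}"
    using zone_dvd[of "P \<oplus> {s}" "P \<oplus> {t}" l] V by auto
  then have "(n - 1) dvd 2" using st by (simp add: eval_nat_numeral)
  then show False using n4 by (auto dest: dvd_imp_le)
qed

section \<open>Convex cycles with two edges in common\<close>

text \<open>\<open>P\<close> and \<open>R\<close> are the antipodes of the middle vertex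
  \<open>x \<oplus> {a}\<close> of the shared path; by \<open>two_classes_eq\<close> they coincide.
  Both cycles then use the same coordinates and have the same two neighbours of
  \<open>x\<close>.\<close>

lemma cyc_same_top_last:
  assumes C: "cyc x (a # b # cs)" "length (a # b # cs) = n"
    and D: "cyc x (a # b # ds)" "length (a # b # ds) = n"
  shows "last cs = last ds"
proof -
  have dist: "distinct (a # b # cs)" "distinct (a # b # ds)"
    using C D cyc_distinct by blast+
  define P R where "P = x \<oplus> set (b # cs)" and "R = x \<oplus> set (b # ds)"
  have "P = R"
  proof (rule two_classes_eq[of P R a b])
    show "P \<in> V" "R \<in> V"
      using cyc_drop[OF C(1), of 1] cyc_drop[OF D(1), of 1] by (simp_all add: P_def R_def)
    have "P \<oplus> {a} = x \<oplus> set (a # b # cs)" "R \<oplus> {a} = x \<oplus> set (a # b # ds)"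
      "P \<oplus> {b} = x \<oplus> set cs" "R \<oplus> {b} = x \<oplus> set ds"
      using dist unfolding P_def R_def by auto
    then show "P \<oplus> {a} \<in> V" "R \<oplus> {a} \<in> V" "P \<oplus> {b} \<in> V" "R \<oplus> {b} \<in> V"
      using cyc_drop[OF C(1), of 0] cyc_drop[OF D(1), of 0] cyc_drop[OF C(1), of 2] cyc_drop[OF D(1), of 2]
      by simp_all
    show "a \<noteq> b" "a \<notin> P \<oplus> R" "b \<notin> P \<oplus> R" using dist by (auto simp: P_def R_def)
    have "P \<oplus> R \<subseteq> set (cs @ ds)" by (auto simp: P_def R_def)
    then have "card (P \<oplus> R) \<le> length (cs @ ds)" by (meson List.finite_set card_length card_mono le_trans)
    then show "card (P \<oplus> R) < 2 * (n - 1)" using C(2) D(2) by simp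
  qed
  then have eq: "set (b # cs) = set (b # ds)" unfolding P_def R_def by simp
  have ne: "cs \<noteq> []" "ds \<noteq> []" using C D n4 by auto
  then obtain cs' l where cs': "cs = cs' @ [l]" by (metis rev_exhaust)
  \<comment> \<open>This neighbour of \<open>x\<close> on the first cycle lies in the subcube of the
    second, where the only neighbours of \<open>x\<close> belong to \<open>a\<close> and
    \<open>last ds\<close>.\<close>
  have "x \<oplus> {l} \<in> V" using cyc_drop[OF C(1), of "length cs' + 2"] cs' by simp
  moreover have "x \<oplus> (x \<oplus> {l}) \<subseteq> set (a # b # ds)" using eq cs' by auto
  ultimately obtain k where k: "{l} = set (take k (a # b # ds)) \<or> {l} = set (drop k (a # b # ds))"
    using D(1) unfolding cyc_def by (metis sdiff_cancel(1))
  have l: "l \<noteq> a" using dist cs' by auto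
  show ?thesis
    using k
  proof
    assume e: "{l} = set (take k (a # b # ds))"
    have "k \<noteq> 0" using e by (intro notI) simp
    then have "a \<in> set (take k (a # b # ds))" by (cases k) auto
    then show ?thesis using e l by auto
  next
    assume e: "{l} = set (drop k (a # b # ds))"
    then have "drop k (a # b # ds) \<noteq> []" by auto
    then have "last (drop k (a # b # ds)) \<in> {l}" using e last_in_set by blast
    then have "last (a # b # ds) = l" using \<open>drop k (a # b # ds) \<noteq> []\<close> by (simp add: last_drop)
    then show ?thesis using ne cs' by simp
  qed
qed

text \<open>Again the antipodes of the middle vertex of the shared path, now
  \<open>x \<oplus> {c, a}\<close>, would have to coincide. But they differ in \<open>c\<close>,
  which the first cycle flips and the second does not.\<close>

lemma cyc_successive_tops:
  assumes C: "cyc x (c # a # b # cs)" "length (c # a # b # cs) = n"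
    and D: "cyc (x \<oplus> {c}) (a # b # ds)" "length (a # b # ds) = n"
    and c: "c \<notin> set ds"
  shows False
proof -
  have dist: "distinct (c # a # b # cs)" "distinct (a # b # ds)"
    using C D cyc_distinct by blast+
  define P R where "P = x \<oplus> set (b # cs)" and "R = x \<oplus> {c} \<oplus> set (b # ds)"
  have "P = R"
  proof (rule two_classes_eq[of P R a b])
    show "P \<in> V" "R \<in> V"
      using cyc_drop[OF C(1), of 2] cyc_drop[OF D(1), of 1] by (simp_all add: P_def R_def)
    have "P \<oplus> {a} = x \<oplus> set (a # b # cs)" "R \<oplus> {a} = x \<oplus> {c} \<oplus> set (a # b # ds)"
      "P \<oplus> {b} = x \<oplus> set cs" "R \<oplus> {b} = x \<oplus> {c} \<oplus> set ds"
      using dist unfolding P_def R_def by auto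
    then show "P \<oplus> {a} \<in> V" "R \<oplus> {a} \<in> V" "P \<oplus> {b} \<in> V" "R \<oplus> {b} \<in> V"
      using cyc_drop[OF C(1), of 1] cyc_drop[OF D(1), of 0] cyc_drop[OF C(1), of 3] cyc_drop[OF D(1), of 2]
      by (simp_all add: eval_nat_numeral)
    show "a \<noteq> b" "a \<notin> P \<oplus> R" "b \<notin> P \<oplus> R" using dist by (auto simp: P_def R_def)
    have "P \<oplus> R \<subseteq> set (c # cs @ ds)" by (auto simp: P_def R_def)
    then have "card (P \<oplus> R) \<le> length (c # cs @ ds)" by (meson List.finite_set card_length card_mono le_trans)
    then show "card (P \<oplus> R) < 2 * (n - 1)" using C(2) D(2) by simp
  qed
  moreover have "c \<in> P \<oplus> R" using dist c by (auto simp: P_def R_def)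
  ultimately show False by simp
qed

section \<open>Cycles below a vertex and the descent\<close>

text \<open>A geodesic from \<open>x \<oplus> {j}\<close> to \<open>w\<close> flips \<open>i\<close>
  at some \<open>W\<close>. The next edge of class \<open>i\<close> after the one at
  \<open>x\<close>, in the interval from \<open>x\<close> to \<open>W\<close>, spans a cycle with
  it. The other edge of this cycle at \<open>x\<close> points towards \<open>W\<close>, whose
  interval has lost \<open>i\<close> but kept \<open>j\<close>: this makes inductions
  possible.\<close>

lemma cyc_towards:
  assumes "x \<in> V" "w \<in> V" "i \<in> x \<oplus> w" "j \<in> x \<oplus> w" "i \<noteq> j" "x \<oplus> {i} \<in> V" "x \<oplus> {j} \<in> V"
  obtains ds W where "cyc x ds" "length ds = n" "set ds \<subseteq> x \<oplus> w" "hd ds = i"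
    "W \<in> V" "x \<oplus> W \<subset> x \<oplus> w" "last ds \<in> x \<oplus> W" "j \<in> x \<oplus> W"
proof -
  have "i \<in> x \<oplus> {j} \<oplus> w" using assms by auto
  then obtain W where W: "W \<in> V" "x \<oplus> {j} \<oplus> W \<subseteq> x \<oplus> {j} \<oplus> w" "i \<notin> x \<oplus> {j} \<oplus> W" "W \<oplus> {i} \<in> V"
    using crossing assms by blast
  have jW: "j \<in> x \<oplus> W" using W(2) assms(4) by auto
  have iW: "i \<notin> x \<oplus> W" using W(3) assms(5) by auto
  have sub: "x \<oplus> W \<subset> x \<oplus> w" using W(2) assms(3,4) iW by (auto split: if_splits)
  \<comment> \<open>Minimal distance from \<open>x\<close> will make \<open>y\<close> consecutive to
    \<open>x\<close>; \<open>W\<close> is a candidate, as \<open>j \<in> x \<oplus> W\<close> gives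
    \<open>W \<noteq> x\<close>.\<close>
  define Q where "Q y \<longleftrightarrow> y \<in> V \<and> x \<oplus> y \<subseteq> x \<oplus> W \<and> y \<noteq> x \<and> y \<oplus> {i} \<in> V" for y
  have "Q W" using W jW unfolding Q_def by auto
  then obtain y where y: "Q y" "\<And>y'. Q y' \<Longrightarrow> card (x \<oplus> y) \<le> card (x \<oplus> y')"
    using ex_has_least_nat[of Q W "\<lambda>y. card (x \<oplus> y)"] by blast
  have "zone_adjacent i x y"
    unfolding zone_adjacent_def
  proof (intro conjI ballI impI)
    show "i \<notin> x \<oplus> y" using y(1) iW Q_def by auto
    fix z assume z: "z \<in> V" "x \<oplus> z \<subseteq> x \<oplus> y" "z \<oplus> {i} \<in> V"
    show "z = x \<or> z = y"
    proof (rule ccontr)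
      assume n: "\<not> (z = x \<or> z = y)"
      have "Q z" using z n y(1) unfolding Q_def by auto
      moreover have "card (x \<oplus> z) < card (x \<oplus> y)"
        using z n assms(1) y(1) fin by (intro psubset_card_mono) (auto simp: Q_def)
      ultimately show False using y(2) by force
    qed
  qed (use y(1) assms Q_def in auto)
  then obtain cs where cs: "set cs = x \<oplus> y" "cyc x (cs @ [i])" and c: "card (x \<oplus> y) = n - 1"
    using zone_adjacent_cyc zone by metis
  have "length cs = n - 1" using c cs cyc_distinct[OF cs(2)] distinct_card[of cs] by simp
  then have len: "length (rev (cs @ [i])) = n" and ne: "cs \<noteq> []" using n4 by auto
  have hd: "hd cs \<in> x \<oplus> W" using ne cs(1) y(1) hd_in_set[OF ne] unfolding Q_def by blast
  show thesis
  proof (rule that[of "rev (cs @ [i])" W])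
    show "cyc x (rev (cs @ [i]))" using cs cyc_rev by blast
    show "set (rev (cs @ [i])) \<subseteq> x \<oplus> w" using cs(1) y(1) sub assms(3) unfolding Q_def by auto
    show "last (rev (cs @ [i])) \<in> x \<oplus> W" using hd ne by (simp add: last_rev)
  qed (use len W sub jW in auto)
qed

text \<open>The inclusion in \<open>x \<oplus> z\<close> puts the whole cycle between
  \<open>x\<close> and \<open>z\<close>, with \<open>x\<close> as its top: the two classes are those
  of its edges at \<open>x\<close>, both leading down to \<open>z\<close>.\<close>

definition top_rel :: "'a set \<Rightarrow> 'a set \<Rightarrow> ('a \<times> 'a) set" where
  "top_rel x z = {(i, j). \<exists>ds. cyc x ds \<and> length ds = n \<and> set ds \<subseteq> x \<oplus> z \<and> hd ds = i \<and> last ds = j}"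

lemma top_rel_sym: "(i, j) \<in> top_rel x z \<Longrightarrow> (j, i) \<in> top_rel x z"
proof -
  assume "(i, j) \<in> top_rel x z"
  then obtain ds where ds: "cyc x ds" "length ds = n" "set ds \<subseteq> x \<oplus> z" "hd ds = i" "last ds = j"
    unfolding top_rel_def by blast
  moreover have "ds \<noteq> []" using ds n4 by auto
  ultimately show ?thesis
    unfolding top_rel_def using cyc_rev[OF ds(1)] by (auto intro!: exI[of _ "rev ds"] simp: hd_rev last_rev)
qed

text \<open>Each cycle from \<open>cyc_towards\<close> exchanges \<open>i\<close> for another class
  at \<open>x\<close>, inside a smaller interval that still contains \<open>j\<close>.\<close>

lemma top_rel_connected:
  assumes "x \<in> V" "w \<in> V" "x \<oplus> w \<subseteq> x \<oplus> z" "i \<in> x \<oplus> w" "j \<in> x \<oplus> w" "x \<oplus> {i} \<in> V" "x \<oplus> {j} \<in> V"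
  shows "(i, j) \<in> (top_rel x z)\<^sup>*"
  using assms
proof (induction "card (x \<oplus> w)" arbitrary: w i rule: less_induct)
  case less
  show ?case
  proof (cases "i = j")
    case False
    obtain ds W where ds: "cyc x ds" "length ds = n" "set ds \<subseteq> x \<oplus> w" "hd ds = i"
      and W: "W \<in> V" "x \<oplus> W \<subset> x \<oplus> w" "last ds \<in> x \<oplus> W" "j \<in> x \<oplus> W"
      using cyc_towards[of x w i j] less.prems False by blast
    have "card (x \<oplus> W) < card (x \<oplus> w)"
      using W(2) fin less.prems by (intro psubset_card_mono) auto
    moreover have "x \<oplus> {last ds} \<in> V"
    proof -
      have "ds \<noteq> []" using ds n4 by auto
      then have "drop (n - 1) ds = [last ds]" using ds(2)
        by (metis append_butlast_last_id append_eq_conv_conj length_butlast)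
      then show ?thesis using cyc_drop[OF ds(1), of "n - 1"] by simp
    qed
    ultimately have "(last ds, j) \<in> (top_rel x z)\<^sup>*"
      using less.hyps[of W "last ds"] W less.prems by blast
    moreover have "(i, last ds) \<in> top_rel x z"
      unfolding top_rel_def using ds less.prems by blast
    ultimately show ?thesis by (rule converse_rtrancl_into_rtrancl[rotated])
  qed simp
qed

text \<open>Infinite descent: a second way down from \<open>x \<oplus> {c}\<close> yields a cycle with top \<open>x \<oplus> {c}\<close> through
  the next vertex of the given cycle; the two cycles part there, which reproduces the situation
  one step closer to \<open>z\<close>.\<close>

lemma no_branching:
  assumes "z \<in> V" "cyc x (c # a # cs)" "length (c # a # cs) = n" "set (c # a # cs) \<subseteq> x \<oplus> z"
    and "e \<noteq> a" "e \<in> x \<oplus> {c} \<oplus> z" "x \<oplus> {c} \<oplus> {e} \<in> V"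
  shows False
  using assms(2-)
proof (induction "card (x \<oplus> z)" arbitrary: x c a cs e rule: less_induct)
  case less
  note C = less.prems(1-3)
  have dist: "distinct (c # a # cs)" using C cyc_distinct by blast
  let ?x = "x \<oplus> {c}"
  have xV: "x \<in> V" "?x \<in> V"
    using cyc_take[OF C(1), of 0] cyc_take[OF C(1), of 1] by simp_all
  have "?x \<oplus> {a} = x \<oplus> {c, a}" using dist by auto
  then have aV: "?x \<oplus> {a} \<in> V" using cyc_take[OF C(1), of 2] by simp
  have "a \<in> ?x \<oplus> z" using C(3) dist by auto
  then obtain ds where ds: "cyc ?x ds" "length ds = n" "set ds \<subseteq> ?x \<oplus> z" "hd ds = a"
    using cyc_towards[of ?x z a e] xV aV less.prems assms(1) by metis
  obtain b ds' where ds': "ds = a # b # ds'"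
    using ds(2,4) n4 by (cases ds; cases "tl ds") auto
  obtain f cs' where cs': "cs = f # cs'" using C(2) n4 by (cases cs) auto
  \<comment> \<open>The cycle \<open>ds\<close> lies between \<open>x \<oplus> {c}\<close> and
    \<open>z\<close>, where \<open>c\<close> is no longer flipped, so
    \<open>cyc_successive_tops\<close> applies.\<close>
  have fb: "f \<noteq> b"
  proof
    assume "f = b"
    moreover have "c \<notin> set ds" using ds(3) C(3) by auto
    ultimately show False
      using cyc_successive_tops[of x c a b cs' ds'] C ds cs' ds' by auto
  qed
  have "?x \<oplus> {a} \<oplus> {f} = x \<oplus> {c, a, f}" using dist cs' by auto
  then have fV: "?x \<oplus> {a} \<oplus> {f} \<in> V"
    using cyc_take[OF C(1), of 3] cs' by (simp add: eval_nat_numeral)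
  have fz: "f \<in> ?x \<oplus> {a} \<oplus> z" using C(3) cs' dist by auto
  have "c \<in> x \<oplus> z" using C(3) by simp
  then have "card (?x \<oplus> z) < card (x \<oplus> z)"
    using card_sdiff_flip(1)[of x z c] fin xV assms(1) by fastforce
  \<comment> \<open>Now \<open>ds\<close> is the given cycle, \<open>x \<oplus> {c}\<close> its top,
    and \<open>f\<close> the second way down from \<open>x \<oplus> {c} \<oplus> {a}\<close> besides
    \<open>b\<close>.\<close>
  then show ?case
    using less.hyps ds(1-3)[unfolded ds'] fb fz fV by blast
qed

lemma at_most_two_down:
  assumes "x \<in> V" "z \<in> V" "i \<in> x \<oplus> z" "j \<in> x \<oplus> z" "k \<in> x \<oplus> z"
    and "x \<oplus> {i} \<in> V" "x \<oplus> {j} \<in> V" "x \<oplus> {k} \<in> V"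
    and ne: "i \<noteq> j" "i \<noteq> k" "j \<noteq> k"
  shows False
proof -
  let ?R = "top_rel x z"
  have conn: "(i, j) \<in> ?R\<^sup>*" "(i, k) \<in> ?R\<^sup>*"
    using top_rel_connected[of x z z] assms by auto
  \<comment> \<open>Otherwise every class has at most one partner, and by symmetry only
    \<open>i\<close> and its partner could be reached from \<open>i\<close>.\<close>
  have "\<exists>p q r. (q, p) \<in> ?R \<and> (q, r) \<in> ?R \<and> p \<noteq> r"
  proof (rule ccontr)
    assume "\<not> ?thesis"
    then have un: "\<And>p q r. (q, p) \<in> ?R \<Longrightarrow> (q, r) \<in> ?R \<Longrightarrow> p = r" by blast
    obtain a where a: "(i, a) \<in> ?R" using conn(1) ne(1) by (meson converse_rtranclE)
    have "y = i \<or> y = a" if "(i, y) \<in> ?R\<^sup>*" for y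
      using that
    proof (induction rule: rtrancl_induct)
      case (step y z)
      then show ?case using un a top_rel_sym by blast
    qed simp
    then show False using conn ne by metis
  qed
  then obtain p q r where "(q, p) \<in> ?R" "(q, r) \<in> ?R" and pr: "p \<noteq> r" by blast
  then obtain cs ds where cs: "cyc x cs" "length cs = n" "set cs \<subseteq> x \<oplus> z" "hd cs = q" "last cs = p"
    and ds: "cyc x ds" "length ds = n" "set ds \<subseteq> x \<oplus> z" "hd ds = q" "last ds = r"
    unfolding top_rel_def by blast
  obtain a cs' where cs': "cs = q # a # cs'" using cs(2,4) n4 by (cases cs; cases "tl cs") auto
  obtain b ds' where ds': "ds = q # b # ds'" using ds(2,4) n4 by (cases ds; cases "tl ds") auto
  have nn: "cs' \<noteq> []" "ds' \<noteq> []" using cs cs' ds ds' n4 by auto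
  have "a \<noteq> b"
  proof
    assume "a = b"
    then have "last cs' = last ds'" using cyc_same_top_last[of x q a cs' ds'] cs ds cs' ds' by simp
    then show False using pr cs ds cs' ds' nn by simp
  qed
  have dd: "distinct ds" using ds cyc_distinct by blast
  have "x \<oplus> {q} \<oplus> {b} = x \<oplus> {q, b}" using dd ds' by auto
  then have "x \<oplus> {q} \<oplus> {b} \<in> V" using cyc_take[OF ds(1), of 2] ds' by simp
  moreover have "b \<in> x \<oplus> {q} \<oplus> z" using ds(3) ds' dd by auto
  ultimately show False
    using no_branching[of z x q a cs' b] assms(2) cs cs' \<open>a \<noteq> b\<close> by auto
qed

end

section \<open>Partial cubes as set families\<close>

lemma walk_Cons:
  "walk G (u # xs) \<longleftrightarrow> u \<in> verts G \<and> (xs = [] \<or> adj G u (hd xs) \<and> walk G xs)"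
proof (cases xs)
  case Nil
  then show ?thesis by (auto simp: walk_def)
next
  case (Cons v ys)
  have "(\<forall>i. i + 1 < length (u # xs) \<longrightarrow> adj G ((u # xs) ! i) ((u # xs) ! (i + 1))) \<longleftrightarrow>
    adj G u v \<and> (\<forall>i. i + 1 < length xs \<longrightarrow> adj G (xs ! i) (xs ! (i + 1)))" (is "?l \<longleftrightarrow> ?r")
  proof
    assume l: ?l
    have "adj G u v" using l[rule_format, of 0] Cons by simp
    moreover have "adj G (xs ! i) (xs ! (i + 1))" if "i + 1 < length xs" for i
      using l[rule_format, of "Suc i"] that by simp
    ultimately show ?r by blast
  next
    assume r: ?r
    show ?l
    proof (intro allI impI)
      fix i assume "i + 1 < length (u # xs)"
      then show "adj G ((u # xs) ! i) ((u # xs) ! (i + 1))"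
        using r Cons by (cases i) auto
    qed
  qed
  then show ?thesis using Cons by (auto simp: walk_def)
qed

lemma walk_take: "walk G xs \<Longrightarrow> walk G (take (Suc k) xs)"
  by (auto simp: walk_def dest: in_set_takeD)

lemma walk_drop: "walk G xs \<Longrightarrow> k < length xs \<Longrightarrow> walk G (drop k xs)"
  by (auto simp: walk_def dest: in_set_dropD)

lemma dist_le: "walk G xs \<Longrightarrow> dist G (hd xs) (last xs) \<le> enat (length xs - 1)"
  unfolding dist_def by (rule INF_lower) auto

lemma dist_leD:
  assumes "dist G u v \<le> enat m"
  obtains xs where "walk G xs" "hd xs = u" "last xs = v" "length xs - 1 \<le> m"
proof (rule ccontr)
  assume "\<not> thesis"
  then have "\<And>xs. walk G xs \<and> hd xs = u \<and> last xs = v \<Longrightarrow> Suc m \<le> length xs - 1"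
    using that not_less_eq_eq by blast
  then have "enat (Suc m) \<le> dist G u v"
    unfolding dist_def by (intro INF_greatest) auto
  then have "enat (Suc m) \<le> enat m" using assms by (rule order_trans)
  then show False by simp
qed

text \<open>The labelling \<open>f\<close> is the identity for subgraphs of the cube and the
  embedding for \<open>G\<close>.\<close>

lemma walk_card_le:
  assumes "\<And>u v. u \<in> verts G \<Longrightarrow> v \<in> verts G \<Longrightarrow> adj G u v \<Longrightarrow> card (f u \<oplus> f v) = 1"
    and "\<And>u. u \<in> verts G \<Longrightarrow> finite (f u)" and "walk G xs"
  shows "card (f (hd xs) \<oplus> f (last xs)) \<le> length xs - 1"
  using assms(3)
proof (induction xs)
  case (Cons u xs)
  show ?case
  proof (cases "xs = []")
    case False
    then have w: "walk G xs" "adj G u (hd xs)" "u \<in> verts G" using Cons.prems by (auto simp: walk_Cons)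
    have vs: "hd xs \<in> verts G" "last xs \<in> verts G" using w(1) False by (auto simp: walk_def)
    have "card (f u \<oplus> f (last xs)) \<le> card (f u \<oplus> f (hd xs)) + card (f (hd xs) \<oplus> f (last xs))"
      using assms(2) w vs by (intro card_sdiff_triangle) auto
    also have "\<dots> \<le> 1 + (length xs - 1)" using Cons.IH w assms(1)[OF w(3) vs(1)] by simp
    finally show ?thesis using False by (cases xs) auto
  qed simp
qed (simp add: walk_def)

lemma adj_commute: "adj G u v \<longleftrightarrow> adj G v u"
  by (simp add: adj_def insert_commute)

lemma adj_hypercube:
  assumes "A \<subseteq> {0..<N}" "B \<subseteq> {0..<N}"
  shows "adj (hypercube N) A B \<longleftrightarrow> card (A \<oplus> B) = 1"
proof -
  have "adj (hypercube N) A B \<longleftrightarrow>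
      (\<exists>A' B'. {A, B} = {A', B'} \<and> A' \<subseteq> {0..<N} \<and> B' \<subseteq> {0..<N} \<and> card (A' \<oplus> B') = 1)"
    by (auto simp: adj_def hypercube_def edges_def sdiff_def)
  also have "\<dots> \<longleftrightarrow> card (A \<oplus> B) = 1"
    using assms by (auto simp: doubleton_eq_iff sdiff_commute)
  finally show ?thesis .
qed

lemma hypercube_walk:
  assumes "A \<subseteq> {0..<N}" "B \<subseteq> {0..<N}"
  shows "\<exists>xs. walk (hypercube N) xs \<and> hd xs = A \<and> last xs = B \<and> length xs = Suc (card (A \<oplus> B))"
  using assms(1)
proof (induction "card (A \<oplus> B)" arbitrary: A)
  case 0
  have "finite (A \<oplus> B)" using 0 assms(2) finite_subset by (metis finite_atLeastLessThan finite_sdiff)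
  then have "A = B" using 0 by simp
  then show ?case using assms(2) by (intro exI[of _ "[A]"]) (auto simp: walk_def hypercube_def verts_def)
next
  case (Suc m)
  have fin: "finite A" "finite B" using Suc.prems assms(2) finite_subset by auto
  from Suc(2) obtain i where i: "i \<in> A \<oplus> B" by (metis card.empty ex_in_conv nat.distinct(1))
  then have "m = card (A \<oplus> {i} \<oplus> B)" using card_sdiff_flip(1)[OF fin, of i] Suc.hyps(2) by linarith
  moreover have iA: "A \<oplus> {i} \<subseteq> {0..<N}" using i Suc.prems assms(2) by (auto simp: subset_iff)
  ultimately obtain xs where xs: "walk (hypercube N) xs" "hd xs = A \<oplus> {i}" "last xs = B"
    "length xs = Suc (card (A \<oplus> {i} \<oplus> B))" using Suc.hyps(1) by blast
  have "adj (hypercube N) A (A \<oplus> {i})" using adj_hypercube[OF Suc.prems iA] by simp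
  moreover have "A \<in> verts (hypercube N)" using Suc.prems by (auto simp: hypercube_def verts_def)
  moreover have "xs \<noteq> []" using xs by auto
  ultimately show ?case
    using xs \<open>m = _\<close> Suc(2) by (intro exI[of _ "A # xs"]) (auto simp: walk_Cons)
qed

lemma card_sdiff_1: "card (A \<oplus> B) = 1 \<longleftrightarrow> (\<exists>i. B = A \<oplus> {i})"
  by (metis One_nat_def card_1_singletonE card_Suc_eq card.empty sdiff_cancel(1) singletonD empty_iff)

text \<open>Isometry supplies a walk in \<open>H\<close> as short as the cube allows; its first edge
  is the required flip, and a walk of length one is an edge.\<close>

lemma isometric_subgraph_hypercube:
  assumes "isometric_subgraph H (hypercube N)"
  shows "isometric_family (verts H)"
    and "A \<in> verts H \<Longrightarrow> B \<in> verts H \<Longrightarrow> adj H A B \<longleftrightarrow> card (A \<oplus> B) = 1"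
proof -
  have sub: "A \<subseteq> {0..<N}" if "A \<in> verts H" for A
    using assms that by (auto simp: isometric_subgraph_def subgraph_def hypercube_def verts_def)
  have adj1: "card (A \<oplus> B) = 1" if "A \<in> verts H" "B \<in> verts H" "adj H A B" for A B
    using that assms adj_hypercube[OF sub sub]
    by (auto simp: isometric_subgraph_def subgraph_def adj_def)
  have fin: "finite A" if "A \<in> verts H" for A using sub[OF that] finite_subset by blast
  have short: "\<exists>xs. walk H xs \<and> hd xs = A \<and> last xs = B \<and> length xs - 1 \<le> card (A \<oplus> B)"
    if "A \<in> verts H" "B \<in> verts H" for A B
  proof -
    have "dist H A B = dist (hypercube N) A B" using assms that by (auto simp: isometric_subgraph_def)
    also have "\<dots> \<le> enat (card (A \<oplus> B))"
      using hypercube_walk[OF sub sub, OF that] dist_le by (metis diff_Suc_1)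
    finally show ?thesis by (rule dist_leD) blast
  qed
  show "isometric_family (verts H)"
  proof
    fix A B assume AB: "A \<in> verts H" "B \<in> verts H" "A \<noteq> B"
    then obtain xs where xs: "walk H xs" "hd xs = A" "last xs = B" "length xs - 1 \<le> card (A \<oplus> B)"
      using short by blast
    then obtain ys where ys: "xs = A # ys" by (cases xs) (auto simp: walk_def)
    have ne: "ys \<noteq> []" using ys xs AB by auto
    then have w: "adj H A (hd ys)" "walk H ys" using xs ys by (auto simp: walk_Cons)
    then have C: "hd ys \<in> verts H" using ne by (auto simp: walk_def)
    then obtain i where i: "hd ys = A \<oplus> {i}" using adj1 AB w card_sdiff_1 by metis
    have "card (hd ys \<oplus> last ys) \<le> length ys - 1"
      using walk_card_le[of H "\<lambda>x. x"] adj1 fin w by blast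
    then have "card (A \<oplus> {i} \<oplus> B) < card (A \<oplus> B)"
      using xs ys ne i by (cases ys) auto
    \<comment> \<open>The remaining walk is too short for the first flip to have led away from
      \<open>B\<close>.\<close>
    then have "i \<in> A \<oplus> B" using card_sdiff_flip(2)[of A B i] fin AB by fastforce
    then show "\<exists>i\<in>A \<oplus> B. A \<oplus> {i} \<in> verts H" using i C by metis
  qed (rule fin)
  show "adj H A B \<longleftrightarrow> card (A \<oplus> B) = 1" if AB: "A \<in> verts H" "B \<in> verts H"
  proof
    assume c: "card (A \<oplus> B) = 1"
    then obtain xs where xs: "walk H xs" "hd xs = A" "last xs = B" "length xs \<le> 2"
      using short[OF AB] by fastforce
    have "A \<noteq> B" using c by auto
    then obtain y where "xs = [A, y]" using xs by (cases xs; cases "tl xs") (auto simp: walk_def)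
    then show "adj H A B" using xs by (simp add: walk_Cons)
  qed (use adj1 AB in blast)
qed

locale cube_embedding =
  fixes G :: "'a graph" and f :: "'a \<Rightarrow> 'b set"
  assumes simple: "sgraph G" and fin_verts: "finite (verts G)"
    and inj: "inj_on f (verts G)"
    and adj_iff: "u \<in> verts G \<Longrightarrow> v \<in> verts G \<Longrightarrow> adj G u v \<longleftrightarrow> card (f u \<oplus> f v) = 1"
    and iso: "isometric_family (f ` verts G)"

lemma partial_cube_embedding:
  fixes G :: "'a graph"
  assumes "sgraph G" "finite (verts G)" "partial_cube G"
  obtains f :: "'a \<Rightarrow> nat set" where "cube_embedding G f"
proof -
  obtain N H f where H: "isometric_subgraph H (hypercube N)"
    and f: "bij_betw f (verts G) (verts H)"
      "\<And>u v. u \<in> verts G \<Longrightarrow> v \<in> verts G \<Longrightarrow> adj G u v \<longleftrightarrow> adj H (f u) (f v)"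
    using assms(3) unfolding partial_cube_def isomorphic_def by blast
  have im: "f ` verts G = verts H" using f(1) bij_betw_imp_surj_on by blast
  have "cube_embedding G f"
  proof (rule cube_embedding.intro)
    show "inj_on f (verts G)" using f(1) bij_betw_imp_inj_on by blast
    show "isometric_family (f ` verts G)" using isometric_subgraph_hypercube(1)[OF H] im by simp
    fix u v assume uv: "u \<in> verts G" "v \<in> verts G"
    then have "f u \<in> verts H" "f v \<in> verts H" using im by auto
    then show "adj G u v \<longleftrightarrow> card (f u \<oplus> f v) = 1"
      using f(2) uv isometric_subgraph_hypercube(2)[OF H] by simp
  qed (use assms in auto)
  then show thesis by (rule that)
qed

section \<open>Subcubes of the embedded graph and their convexity\<close>

definition induced :: "'a graph \<Rightarrow> 'a set \<Rightarrow> 'a graph" where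
  "induced G W = (W, {e \<in> edges G. e \<subseteq> W})"

lemma verts_induced [simp]: "verts (induced G W) = W"
  and adj_induced: "adj (induced G W) u v \<longleftrightarrow> adj G u v \<and> u \<in> W \<and> v \<in> W"
  by (auto simp: induced_def verts_def edges_def adj_def)

lemma induced_verts:
  assumes "sgraph G"
  shows "induced G (verts G) = G"
proof -
  have "{e \<in> edges G. e \<subseteq> verts G} = edges G" using assms unfolding sgraph_def by fastforce
  then show ?thesis by (simp add: induced_def verts_def edges_def)
qed

lemma walk_induced:
  assumes "W \<subseteq> verts G" "walk (induced G W) xs"
  shows "walk G xs"
  using assms by (auto simp: walk_def adj_induced)

context cube_embedding
begin

sublocale isometric_family "f ` verts G" by (rule iso)

lemma walk_length:
  assumes "walk G xs"
  shows "card (f (hd xs) \<oplus> f (last xs)) \<le> length xs - 1"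
  using walk_card_le[of G f xs] adj_iff fin assms by blast

text \<open>Each vertex cuts the walk into two parts, neither shorter than the distance of its ends
  in the cube; so the triangle inequality is tight there.\<close>

lemma walk_in_interval:
  assumes w: "walk G xs" and len: "length xs - 1 = card (f (hd xs) \<oplus> f (last xs))" and i: "i < length xs"
  shows "f (hd xs) \<oplus> f (xs ! i) \<subseteq> f (hd xs) \<oplus> f (last xs)"
proof (rule card_sdiff_between)
  have ne: "xs \<noteq> []" using w by (simp add: walk_def)
  have "hd xs \<in> verts G" "last xs \<in> verts G" "xs ! i \<in> verts G" using w i ne by (auto simp: walk_def)
  then show "finite (f (hd xs))" "finite (f (last xs))" "finite (f (xs ! i))" using fin by auto
  have "hd (take (Suc i) xs) = hd xs" using ne by (cases xs) auto
  moreover have "last (take (Suc i) xs) = xs ! i" using i by (simp add: take_Suc_conv_app_nth)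
  ultimately have "card (f (hd xs) \<oplus> f (xs ! i)) \<le> i"
    using walk_length[OF walk_take[OF w, of i]] i by simp
  moreover have "hd (drop i xs) = xs ! i" "last (drop i xs) = last xs" using i by (simp_all add: hd_drop_conv_nth)
  then have "card (f (xs ! i) \<oplus> f (last xs)) \<le> length xs - 1 - i"
    using walk_length[OF walk_drop[OF w i]] by simp
  ultimately show "card (f (hd xs) \<oplus> f (xs ! i)) + card (f (xs ! i) \<oplus> f (last xs)) \<le> card (f (hd xs) \<oplus> f (last xs))"
    using len i by linarith
qed

text \<open>Covers both the cycles, with \<open>S\<close> their coordinates, and \<open>G\<close>
  itself, with \<open>S = UNIV\<close>, so distances are computed only once.\<close>

definition subcube :: "'b set \<Rightarrow> 'b set \<Rightarrow> 'a set" where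
  "subcube P S = {u \<in> verts G. P \<oplus> f u \<subseteq> S}"

lemma subcube_walk:
  assumes "u \<in> subcube P S" "v \<in> subcube P S"
  shows "\<exists>xs. walk (induced G (subcube P S)) xs \<and> hd xs = u \<and> last xs = v \<and> length xs = Suc (card (f u \<oplus> f v))"
  using assms(1)
proof (induction "card (f u \<oplus> f v)" arbitrary: u rule: less_induct)
  case less
  have uv: "u \<in> verts G" "v \<in> verts G" using less.prems assms(2) by (auto simp: subcube_def)
  show ?case
  proof (cases "u = v")
    case True
    then show ?thesis using less.prems by (intro exI[of _ "[u]"]) (simp add: walk_def)
  next
    case False
    then have "f u \<noteq> f v" using inj uv by (simp add: inj_on_eq_iff)
    then obtain i where i: "i \<in> f u \<oplus> f v" "f u \<oplus> {i} \<in> f ` verts G"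
      using step[of "f u" "f v"] uv by blast
    then obtain u' where u': "u' \<in> verts G" "f u' = f u \<oplus> {i}" by auto
    have "u' \<in> subcube P S"
      using less.prems assms(2) u' i(1) by (auto simp: subcube_def subset_iff)
    moreover have c: "Suc (card (f u' \<oplus> f v)) = card (f u \<oplus> f v)"
      using card_sdiff_flip(1)[OF _ _ i(1)] fin uv u' by simp
    ultimately obtain xs where xs: "walk (induced G (subcube P S)) xs" "hd xs = u'" "last xs = v"
      "length xs = Suc (card (f u' \<oplus> f v))"
      using less.hyps[of u'] by auto
    moreover have "adj G u u'" using adj_iff uv u' by simp
    ultimately have "walk (induced G (subcube P S)) (u # xs)"
      using less.prems \<open>u' \<in> subcube P S\<close> by (simp add: walk_Cons adj_induced)
    moreover have "xs \<noteq> []" using xs by auto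
    ultimately show ?thesis using xs c by (intro exI[of _ "u # xs"]) simp
  qed
qed

lemma dist_subcube:
  assumes "u \<in> subcube P S" "v \<in> subcube P S"
  shows "dist (induced G (subcube P S)) u v = enat (card (f u \<oplus> f v))"
proof (rule antisym)
  show "dist (induced G (subcube P S)) u v \<le> enat (card (f u \<oplus> f v))"
    using subcube_walk[OF assms] dist_le[of "induced G (subcube P S)"] by (metis diff_Suc_1)
  have "subcube P S \<subseteq> verts G" by (auto simp: subcube_def)
  then show "enat (card (f u \<oplus> f v)) \<le> dist (induced G (subcube P S)) u v"
    unfolding dist_def using walk_length[OF walk_induced] by (intro INF_greatest) auto
qed

lemma subcube_UNIV: "subcube P UNIV = verts G"
  by (simp add: subcube_def)

lemma dist_eq:
  assumes "u \<in> verts G" "v \<in> verts G"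
  shows "dist G u v = enat (card (f u \<oplus> f v))"
  using dist_subcube[of u "{}" UNIV v] assms induced_verts[OF simple] by (simp add: subcube_UNIV)

lemma connected_walk:
  assumes "u \<in> verts G" "v \<in> verts G"
  obtains xs where "walk G xs" "hd xs = u" "last xs = v"
  using subcube_walk[of u "{}" UNIV v] assms induced_verts[OF simple] by (auto simp: subcube_UNIV)

text \<open>A geodesic flips only coordinates in which its ends differ, and these belong to
  \<open>S\<close>.\<close>

lemma convex_subcube: "convex_subgraph (induced G (subcube P S)) G"
proof -
  let ?W = "subcube P S"
  have W: "?W \<subseteq> verts G" by (auto simp: subcube_def)
  have "sgraph (induced G ?W)"
    using simple unfolding sgraph_def induced_def edges_def verts_def by fastforce
  then have "subgraph (induced G ?W) G"
    using W by (auto simp: subgraph_def induced_def edges_def verts_def)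
  then have isom: "isometric_subgraph (induced G ?W) G"
    unfolding isometric_subgraph_def using dist_subcube[of _ P S] dist_eq[of _ _] W by (simp add: subset_iff)
  moreover have "set xs \<subseteq> ?W \<and> (\<forall>i. i + 1 < length xs \<longrightarrow> {xs ! i, xs ! (i + 1)} \<in> edges (induced G ?W))"
    if uv: "u \<in> ?W" "v \<in> ?W" and xs: "walk G xs" "hd xs = u" "last xs = v" "enat (length xs - 1) = dist G u v"
    for u v xs
  proof -
    have len: "length xs - 1 = card (f (hd xs) \<oplus> f (last xs))"
      using xs dist_eq[of u v] subsetD[OF W uv(1)] subsetD[OF W uv(2)] by simp
    have inW: "xs ! i \<in> ?W" if i: "i < length xs" for i
    proof -
      have "xs ! i \<in> verts G" using i xs(1) by (auto simp: walk_def)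
      moreover have "f u \<oplus> f (xs ! i) \<subseteq> f u \<oplus> f v" using walk_in_interval[OF xs(1) len i] xs by simp
      then have "P \<oplus> f (xs ! i) \<subseteq> S" using uv by (auto simp: subcube_def subset_iff)
      ultimately show ?thesis by (simp add: subcube_def)
    qed
    then have "set xs \<subseteq> ?W" by (auto simp: in_set_conv_nth)
    moreover have "{xs ! i, xs ! (i + 1)} \<in> edges (induced G ?W)" if "i + 1 < length xs" for i
      using inW[of i] inW[of "i + 1"] that xs(1) adj_induced[of G ?W] by (simp add: walk_def adj_def)
    ultimately show ?thesis by blast
  qed
  ultimately show ?thesis unfolding convex_subgraph_def by auto
qed

lemma degree:
  assumes u: "u \<in> verts G"
  shows "card {v \<in> verts G. adj G u v} = card {i. f u \<oplus> {i} \<in> f ` verts G}"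
proof -
  let ?N = "{v \<in> verts G. adj G u v}" and ?I = "{i. f u \<oplus> {i} \<in> f ` verts G}"
  have "?N = {v \<in> verts G. \<exists>i. f v = f u \<oplus> {i}}"
    using u adj_iff card_sdiff_1 by blast
  then have "f ` ?N = {A \<in> f ` verts G. \<exists>i. A = f u \<oplus> {i}}" by blast
  also have "\<dots> = (\<lambda>i. f u \<oplus> {i}) ` ?I" by blast
  finally have "f ` ?N = (\<lambda>i. f u \<oplus> {i}) ` ?I" .
  moreover have "card (f ` ?N) = card ?N"
    using inj by (intro card_image) (auto intro: inj_on_subset)
  moreover have "card ((\<lambda>i. f u \<oplus> {i}) ` ?I) = card ?I"
    by (intro card_image inj_onI) simp
  ultimately show ?thesis by simp
qed

end

section \<open>Cycles\<close>

text \<open>\<open>arc m k\<close> indexes the coordinates flipped after \<open>k\<close> steps around a cycle of length \<open>2 * m\<close>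
  that flips the coordinates \<open>0, \<dots>, m - 1, 0, \<dots>, m - 1\<close> in this order.\<close>

definition arc :: "nat \<Rightarrow> nat \<Rightarrow> nat set" where
  "arc m k = {i. i < m \<and> i < k \<and> k \<le> i + m}"

text \<open>The right-hand side is the shorter way round between positions \<open>j\<close> and
  \<open>k\<close>. The cases are both positions in the first half, both in the second, and one in
  each with either way being the shorter.\<close>

lemma card_arc_sdiff:
  assumes "j < k" "k \<le> 2 * m"
  shows "card (arc m j \<oplus> arc m k) = (if k - j \<le> m then k - j else 2 * m - (k - j))"
proof -
  consider "k \<le> m" | "m \<le> j" | "j < m" "m < k" "k - j \<le> m" | "j < m" "m < k" "m < k - j"
    by linarith
  then show ?thesis
  proof cases
    case 1
    then have "arc m j \<oplus> arc m k = {j..<k}" using assms by (auto simp: arc_def)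
    moreover have "k - j \<le> m" using 1 by simp
    ultimately show ?thesis by simp
  next
    case 2
    then have "arc m j \<oplus> arc m k = {j - m..<k - m}" using assms by (auto simp: arc_def)
    moreover have "k - j \<le> m" using 2 assms by simp
    ultimately show ?thesis using 2 by simp
  next
    case 3
    then have "arc m j \<oplus> arc m k = {..<k - m} \<union> {j..<m}" using assms by (auto simp: arc_def)
    moreover have "card ({..<k - m} \<union> {j..<m}) = (k - m) + (m - j)"
      using 3 by (subst card_Un_disjoint) auto
    ultimately show ?thesis using 3 by simp
  next
    case 4
    then have "arc m j \<oplus> arc m k = {..<j} \<union> {k - m..<m}" using assms by (auto simp: arc_def)
    moreover have "card ({..<j} \<union> {k - m..<m}) = j + (m - (k - m))"
      using 4 by (subst card_Un_disjoint) auto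
    ultimately show ?thesis using 4 assms by simp
  qed
qed

lemma nth_image_arc_take: "k \<le> length ds \<Longrightarrow> (!) ds ` arc (length ds) k = set (take k ds)"
  by (simp add: nth_image[symmetric]) (auto simp: arc_def)

lemma nth_image_arc_drop:
  assumes "k \<le> length ds"
  shows "(!) ds ` arc (length ds) (k + length ds) = set (drop k ds)"
proof -
  have "arc (length ds) (k + length ds) = {k..<length ds}" by (auto simp: arc_def)
  also have "\<dots> = (+) k ` {..<length ds - k}"
    using image_add_atLeastLessThan[of k 0 "length ds - k"] assms by (simp add: lessThan_atLeast0)
  finally have "arc (length ds) (k + length ds) = (+) k ` {..<length ds - k}" .
  then have "(!) ds ` arc (length ds) (k + length ds) = (\<lambda>i. ds ! (k + i)) ` {..<length ds - k}"
    by (simp add: image_image)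
  also have "\<dots> = set (drop k ds)"
    using assms by (auto simp: set_conv_nth)
  finally show ?thesis .
qed

lemma is_l_cycle_card: "is_l_cycle H l \<Longrightarrow> card (verts H) = l"
  unfolding is_l_cycle_def by (auto simp: distinct_card)

lemma is_l_cycle_two_nbrs:
  assumes "is_l_cycle H l" "v \<in> verts H"
  obtains a b where "a \<in> verts H" "b \<in> verts H" "a \<noteq> b" "adj H v a" "adj H v b"
proof -
  obtain xs where xs: "length xs = l" "l \<ge> 3" "distinct xs" "verts H = set xs"
    "edges H = {{xs ! i, xs ! ((i + 1) mod l)} | i. i < l}"
    using assms(1) unfolding is_l_cycle_def by blast
  obtain k where k: "k < l" "v = xs ! k" using assms(2) xs by (auto simp: in_set_conv_nth)
  define p where "p = (if k = 0 then l - 1 else k - 1)"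
  have p: "p < l" "(p + 1) mod l = k" using k xs(2) by (auto simp: p_def)
  have s: "(k + 1) mod l < l" using k by simp
  have "(k + 1) mod l \<noteq> p"
    using k xs(2) by (cases "k + 1 = l") (auto simp: p_def)
  then have "xs ! ((k + 1) mod l) \<noteq> xs ! p" using xs(1,3) p s by (simp add: nth_eq_iff_index_eq)
  moreover have "adj H v (xs ! ((k + 1) mod l))" using k xs(5) by (auto simp: adj_def)
  moreover have "{xs ! p, xs ! ((p + 1) mod l)} \<in> edges H" using p(1) xs(5) by blast
  then have "adj H v (xs ! p)" using p k by (simp add: adj_def insert_commute)
  moreover have "xs ! ((k + 1) mod l) \<in> verts H" "xs ! p \<in> verts H" using s p xs by simp_all
  ultimately show thesis using that by blast
qed

lemma is_l_cycle_isomorphic: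
  assumes "is_l_cycle G l"
  shows "isomorphic G (cycle_graph l)"
proof -
  obtain xs where xs: "length xs = l" "distinct xs" "verts G = set xs"
    "edges G = {{xs ! i, xs ! ((i + 1) mod l)} | i. i < l}"
    using assms unfolding is_l_cycle_def by blast
  define h where "h = inv_into {..<l} ((!) xs)"
  have bij: "bij_betw ((!) xs) {..<l} (set xs)" using bij_betw_nth xs by blast
  then have "bij_betw h (verts G) (verts (cycle_graph l))"
    using bij_betw_inv_into[OF bij] xs
    by (simp add: h_def cycle_graph_def verts_def lessThan_atLeast0)
  moreover have "adj G u v \<longleftrightarrow> adj (cycle_graph l) (h u) (h v)" if uv: "u \<in> verts G" "v \<in> verts G" for u v
  proof -
    obtain i j where ij: "i < l" "j < l" "u = xs ! i" "v = xs ! j"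
      using uv xs(1,3) by (auto simp: in_set_conv_nth)
    have h: "h u = i" "h v = j"
      using ij bij_betw_inv_into_left[OF bij] by (auto simp: h_def)
    have eq: "{xs ! i, xs ! j} = {xs ! a, xs ! b} \<longleftrightarrow> {i, j} = {a, b}" if "a < l" "b < l" for a b
      using that ij xs by (simp add: doubleton_eq_iff nth_eq_iff_index_eq)
    have m: "(k + 1) mod l < l" if "k < l" for k using that by simp
    have "adj G u v \<longleftrightarrow> (\<exists>k<l. {xs ! i, xs ! j} = {xs ! k, xs ! ((k + 1) mod l)})"
      using ij xs(4) by (auto simp: adj_def)
    also have "\<dots> \<longleftrightarrow> (\<exists>k<l. {i, j} = {k, (k + 1) mod l})"
      using eq m by blast
    also have "\<dots> \<longleftrightarrow> adj (cycle_graph l) (h u) (h v)"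
      using h by (auto simp: adj_def cycle_graph_def edges_def)
    finally show ?thesis .
  qed
  ultimately show ?thesis unfolding isomorphic_def by blast
qed

lemma isomorphic_cycle_degree:
  assumes "isomorphic G (cycle_graph l)" "v \<in> verts G"
  shows "card {u \<in> verts G. adj G v u} \<le> 2"
proof -
  obtain h where h: "bij_betw h (verts G) {0..<l}"
    "\<And>u v. u \<in> verts G \<Longrightarrow> v \<in> verts G \<Longrightarrow> adj G u v \<longleftrightarrow> adj (cycle_graph l) (h u) (h v)"
    using assms(1) unfolding isomorphic_def by (auto simp: cycle_graph_def verts_def)
  let ?N = "{u \<in> verts G. adj G v u}"
  let ?B = "{(h v + 1) mod l, if h v = 0 then l - 1 else h v - 1}"
  have "h u \<in> ?B" if u: "u \<in> verts G" "adj G v u" for u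
  proof -
    have "{h v, h u} \<in> {{i, (i + 1) mod l} | i. i < l}"
      using u h(2) assms(2) by (simp add: adj_def cycle_graph_def edges_def)
    then obtain i where i: "i < l" "{h v, h u} = {i, (i + 1) mod l}" by blast
    then consider "h v = i" "h u = (i + 1) mod l" | "h u = i" "h v = (i + 1) mod l"
      by (auto simp: doubleton_eq_iff)
    then show ?thesis
    proof cases
      case 2
      then show ?thesis using i(1) by (cases "i + 1 = l") auto
    qed simp
  qed
  then have "h ` ?N \<subseteq> ?B" by blast
  then have "card (h ` ?N) \<le> card ?B" by (intro card_mono) auto
  also have "\<dots> \<le> 2" by (simp add: card_insert_if)
  finally have "card (h ` ?N) \<le> 2" .
  moreover have "inj_on h ?N" using h(1) by (auto simp: bij_betw_def intro: inj_on_subset)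
  ultimately show ?thesis by (simp add: card_image)
qed

section \<open>Cycles in the embedded graph and the main equivalence\<close>

context cube_embedding
begin

text \<open>Numbering positions round the cycle merges prefixes and suffixes into one sequence
  \<open>x\<close>. Distinctness and adjacency then both follow from the distance formula
  \<open>card_x\<close>.\<close>

lemma cyc_is_l_cycle:
  assumes cyc: "cyc P ds" and len: "length ds \<ge> 2"
  shows "is_l_cycle (induced G (subcube P (set ds))) (2 * length ds)"
proof -
  define m where "m = length ds"
  define W where "W = subcube P (set ds)"
  define S where "S k = (!) ds ` arc m k" for k
  define x where "x k = inv_into (verts G) f (P \<oplus> S k)" for k
  have dist: "distinct ds" using cyc cyc_distinct by blast
  have S_take: "S k = set (take k ds)" if "k \<le> m" for k
    using that nth_image_arc_take by (simp add: S_def m_def)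
  have S_drop: "S (k + m) = set (drop k ds)" if "k \<le> m" for k
    using that nth_image_arc_drop by (simp add: S_def m_def)
  have SV: "P \<oplus> S k \<in> f ` verts G" if "k \<le> 2 * m" for k
  proof (cases "k \<le> m")
    case False
    then have "S k = set (drop (k - m) ds)" using S_drop[of "k - m"] that by simp
    then show ?thesis using cyc_drop[OF cyc] by simp
  qed (simp add: S_take cyc_take[OF cyc])
  have x: "x k \<in> verts G" "f (x k) = P \<oplus> S k" if "k \<le> 2 * m" for k
    using SV[OF that] by (auto simp: x_def inv_into_into f_inv_into_f)
  have inj_nth: "inj_on ((!) ds) {..<m}" using dist by (simp add: inj_on_def m_def nth_eq_iff_index_eq)
  have card_x: "card (f (x j) \<oplus> f (x k)) = (if k - j \<le> m then k - j else 2 * m - (k - j))"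
    if "j < k" "k \<le> 2 * m" for j k
  proof -
    have "f (x j) \<oplus> f (x k) = S j \<oplus> S k" using x that by auto
    also have "\<dots> = (!) ds ` (arc m j \<oplus> arc m k)"
    proof -
      have "(!) ds ` (arc m a - arc m b) = (!) ds ` arc m a - (!) ds ` arc m b" for a b
        by (rule inj_on_image_set_diff[OF inj_nth]) (auto simp: arc_def)
      then show ?thesis unfolding S_def sdiff_def by (simp add: image_Un)
    qed
    finally have "f (x j) \<oplus> f (x k) = (!) ds ` (arc m j \<oplus> arc m k)" .
    moreover have "inj_on ((!) ds) (arc m j \<oplus> arc m k)"
      by (rule inj_on_subset[OF inj_nth]) (auto simp: arc_def)
    ultimately have "card (f (x j) \<oplus> f (x k)) = card (arc m j \<oplus> arc m k)"
      by (simp add: card_image)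
    then show ?thesis using card_arc_sdiff that by simp
  qed
  have m: "m \<ge> 2" using len m_def by simp
  \<comment> \<open>The last position is the empty suffix, that is \<open>P\<close> again, so
    indices may be reduced modulo \<open>2 * m\<close>.\<close>
  have x_per: "x (2 * m) = x 0"
    using S_drop[of m] S_take[of 0] by (simp add: x_def m_def mult_2)
  have adj_succ: "adj G (x k) (x ((k + 1) mod (2 * m)))" if "k < 2 * m" for k
  proof -
    have "adj G (x k) (x (k + 1))" using card_x[of k "k + 1"] that m x adj_iff by simp
    moreover have "x (k + 1) = x ((k + 1) mod (2 * m))"
      using that x_per by (cases "k + 1 = 2 * m") auto
    ultimately show ?thesis by simp
  qed
  have ne: "x j \<noteq> x k" if "j < k" "k < 2 * m" for j k
  proof
    assume "x j = x k"
    then have "card (f (x j) \<oplus> f (x k)) = 0" by simp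
    then show False using card_x[of j k] that by (auto split: if_splits)
  qed
  define xs where "xs = map x [0..<2 * m]"
  have nth: "xs ! k = x k" if "k < 2 * m" for k using that by (simp add: xs_def)
  have "inj_on x {..<2 * m}"
    by (rule linorder_inj_onI) (use ne in auto)
  then have "distinct xs" by (simp add: xs_def distinct_map lessThan_atLeast0)
  have subW: "x k \<in> W" if "k \<le> 2 * m" for k
  proof -
    have "S k \<subseteq> set ds" by (auto simp: S_def arc_def m_def)
    then show ?thesis using x[OF that] by (simp add: W_def subcube_def)
  qed
  have Wx: "\<exists>k<2 * m. u = x k" if u: "u \<in> W" for u
  proof -
    have uV: "u \<in> verts G" and "P \<oplus> f u \<subseteq> set ds" using u by (auto simp: W_def subcube_def)
    then obtain k where k: "P \<oplus> f u = set (take k ds) \<or> P \<oplus> f u = set (drop k ds)"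
      using cyc unfolding cyc_def by blast
    have "\<exists>k'\<le>2 * m. P \<oplus> f u = S k'"
      using k
    proof
      assume "P \<oplus> f u = set (take k ds)"
      then have "P \<oplus> f u = S (min k m)" using S_take[of "min k m"] by (cases "k \<le> m") (auto simp: m_def)
      then show ?thesis by (intro exI[of _ "min k m"]) auto
    next
      assume "P \<oplus> f u = set (drop k ds)"
      then have "P \<oplus> f u = S (min k m + m)" using S_drop[of "min k m"] by (cases "k \<le> m") (auto simp: m_def)
      then show ?thesis by (intro exI[of _ "min k m + m"]) auto
    qed
    then obtain k' where k': "k' \<le> 2 * m" "P \<oplus> f u = S k'" by blast
    then have "f u = f (x k')" using x(2)[OF k'(1)] by (metis sdiff_cancel(1))
    then have "u = x k'" using inj uV x(1)[OF k'(1)] by (simp add: inj_on_eq_iff)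
    then have "u = x (k' mod (2 * m))" using k'(1) x_per by (cases "k' = 2 * m") auto
    then show ?thesis using m by (intro exI[of _ "k' mod (2 * m)"]) simp
  qed
  have set_xs: "W = set xs" using Wx subW by (fastforce simp: xs_def)
  have adjD: "\<exists>i<2 * m. {x j, x k} = {x i, x ((i + 1) mod (2 * m))}"
    if "j < k" "k < 2 * m" "adj G (x j) (x k)" for j k
  proof -
    have "card (f (x j) \<oplus> f (x k)) = 1" using that adj_iff x by simp
    then have "(if k - j \<le> m then k - j else 2 * m - (k - j)) = 1" using card_x[of j k] that by simp
    then have "k = j + 1 \<or> (j = 0 \<and> k = 2 * m - 1)" using that m by (auto split: if_splits)
    then show ?thesis
    proof
      assume "k = j + 1"
      then show ?thesis using that by (intro exI[of _ j]) simp
    next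
      assume "j = 0 \<and> k = 2 * m - 1"
      then show ?thesis using m by (intro exI[of _ k]) (auto simp: insert_commute)
    qed
  qed
  have "edges (induced G W) = {{x i, x ((i + 1) mod (2 * m))} | i. i < 2 * m}" (is "?E = ?F")
  proof (intro equalityI subsetI)
    fix e assume "e \<in> ?E"
    then have e: "e \<in> edges G" "e \<subseteq> W" by (auto simp: induced_def edges_def)
    then obtain u v where uv: "e = {u, v}" "u \<noteq> v" using simple unfolding sgraph_def by blast
    obtain j k where jk: "j < 2 * m" "k < 2 * m" "u = x j" "v = x k" using Wx[of u] Wx[of v] uv(1) e(2) by auto
    have a: "adj G (x j) (x k)" "adj G (x k) (x j)" using e uv jk by (auto simp: adj_def insert_commute)
    have "j < k \<or> k < j" using jk uv by (metis linorder_neqE_nat)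
    then have "\<exists>i<2 * m. {x j, x k} = {x i, x ((i + 1) mod (2 * m))}"
      using adjD[of j k] adjD[of k j] jk a by (metis insert_commute)
    then show "e \<in> ?F" using uv jk by blast
  next
    fix e assume "e \<in> ?F"
    then obtain i where i: "i < 2 * m" "e = {x i, x ((i + 1) mod (2 * m))}" by blast
    have "x i \<in> W" "x ((i + 1) mod (2 * m)) \<in> W" using subW i m by simp_all
    then show "e \<in> ?E" using adj_succ[OF i(1)] i(2) by (simp add: induced_def edges_def adj_def)
  qed
  also have "\<dots> = {{xs ! i, xs ! ((i + 1) mod (2 * m))} | i. i < 2 * m}"
  proof -
    have "xs ! i = x i \<and> xs ! ((i + 1) mod (2 * m)) = x ((i + 1) mod (2 * m))" if "i < 2 * m" for i
      using nth that m by simp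
    then show ?thesis by (intro Collect_cong) metis
  qed
  finally show ?thesis
    unfolding is_l_cycle_def W_def[symmetric] m_def[symmetric]
    using \<open>distinct xs\<close> set_xs m by (intro exI[of _ xs]) (auto simp: xs_def)
qed

text \<open>A vertex of the cycle already has two neighbours on it, so with degrees at most 2 no
  edge leaves the cycle, and \<open>G\<close> is connected.\<close>

lemma cycle_subgraph_spanning:
  assumes deg: "\<And>v. v \<in> verts G \<Longrightarrow> card {u \<in> verts G. adj G v u} \<le> 2"
    and H: "is_l_cycle H l" "subgraph H G"
  shows "verts H = verts G"
proof -
  have sub: "verts H \<subseteq> verts G" "\<And>u v. adj H u v \<Longrightarrow> adj G u v"
    using H(2) by (auto simp: subgraph_def adj_def)
  have closed: "w \<in> verts H" if v: "v \<in> verts H" and w: "w \<in> verts G" "adj G v w" for v w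
  proof (rule ccontr)
    assume n: "w \<notin> verts H"
    obtain a b where ab: "a \<in> verts H" "b \<in> verts H" "a \<noteq> b" "adj H v a" "adj H v b"
      using is_l_cycle_two_nbrs[OF H(1) v] .
    have "{a, b, w} \<subseteq> {u \<in> verts G. adj G v u}" using ab w sub by blast
    then have "card {a, b, w} \<le> card {u \<in> verts G. adj G v u}"
      using fin_verts by (intro card_mono) auto
    moreover have "a \<noteq> w" "b \<noteq> w" using ab n by auto
    then have "card {a, b, w} = 3" using ab(3) by simp
    ultimately show False using deg[of v] v sub by auto
  qed
  have reach: "last xs \<in> verts H" if "walk G xs" "hd xs \<in> verts H" for xs
    using that
  proof (induction xs)
    case (Cons u xs)
    show ?case
    proof (cases "xs = []")
      case False
      then have "adj G u (hd xs)" "walk G xs" using Cons.prems by (auto simp: walk_Cons)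
      moreover have "hd xs \<in> verts G" using calculation False by (auto simp: walk_def)
      ultimately show ?thesis using closed[of u "hd xs"] Cons False by simp
    qed (use Cons in simp)
  qed (simp add: walk_def)
  have "verts H \<noteq> {}" using H(1) by (auto simp: is_l_cycle_def)
  then obtain u where "u \<in> verts H" by blast
  then show ?thesis using reach connected_walk[of u] sub(1) by (metis subsetI subset_antisym subsetD)
qed

text \<open>The subcube spanned by consecutive edges is a convex cycle, so the assumption fixes its
  number of vertices, hence of coordinates.\<close>

lemma equal_zones_if_convex_cycles:
  assumes "n \<ge> 4" and conv: "\<And>H. convex_cycle H G \<Longrightarrow> is_l_cycle H (2 * n)"
  shows "equal_zones (f ` verts G) n"
proof (intro equal_zones.intro equal_zones_axioms.intro iso assms(1))
  fix s P R assume z: "zone_adjacent s P R"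
  obtain cs where cs: "set cs = P \<oplus> R" "cyc P (cs @ [s])" by (rule zone_adjacent_cyc[OF z])
  have "P \<noteq> R" using z by (simp add: zone_adjacent_def)
  then have "cs \<noteq> []" using cs(1) by auto
  then have "length (cs @ [s]) \<ge> 2" by (cases cs) auto
  then have l: "is_l_cycle (induced G (subcube P (set (cs @ [s])))) (2 * length (cs @ [s]))"
    using cyc_is_l_cycle[OF cs(2)] by blast
  then have "is_l_cycle (induced G (subcube P (set (cs @ [s])))) (2 * n)"
    using conv convex_subcube unfolding convex_cycle_def is_cycle_def by blast
  then have "2 * n = 2 * length (cs @ [s])" using l is_l_cycle_card by metis
  moreover have "card (P \<oplus> R) = length cs"
    using cyc_distinct[OF cs(2)] distinct_card[of cs] cs(1) by simp
  ultimately show "card (P \<oplus> R) = n - 1" by simp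
qed

lemma regular_degree_ge_2:
  assumes reg: "\<And>v. v \<in> verts G \<Longrightarrow> card {u \<in> verts G. adj G v u} = k" and "verts G \<noteq> {}"
    and "\<not> isomorphic G (complete_graph 1)" "\<not> isomorphic G (complete_graph 2)"
  shows "k \<ge> 2"
proof (rule ccontr)
  assume k: "\<not> k \<ge> 2"
  obtain v where v: "v \<in> verts G" using assms(2) by blast
  have irr: "\<not> adj G u u" if "u \<in> verts G" for u using adj_iff[of u u] that by simp
  have "verts G \<noteq> {v}"
  proof
    assume "verts G = {v}"
    then have "isomorphic G (complete_graph 1)"
      unfolding isomorphic_def using irr v
      by (intro exI[of _ "\<lambda>_. 0"]) (auto simp: bij_betw_def complete_graph_def verts_def adj_def edges_def)
    then show False using assms(3) by blast
  qed
  then obtain w where w: "w \<in> verts G" "w \<noteq> v" using v by blast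
  have finN: "finite {u \<in> verts G. adj G x u}" for x using fin_verts by simp
  have one: "u = u'" if "x \<in> verts G" "u \<in> verts G" "u' \<in> verts G" "adj G x u" "adj G x u'" for x u u'
  proof (rule ccontr)
    assume "u \<noteq> u'"
    then have "card {u, u'} = 2" by simp
    moreover have "card {u, u'} \<le> card {u \<in> verts G. adj G x u}"
      using that finN by (intro card_mono) auto
    ultimately show False using reg that k by simp
  qed
  have stepG: "\<exists>u\<in>verts G. adj G x u \<and> card (f u \<oplus> f y) < card (f x \<oplus> f y)"
    if xy: "x \<in> verts G" "y \<in> verts G" "x \<noteq> y" for x y
  proof -
    have "f x \<noteq> f y" using inj xy by (simp add: inj_on_eq_iff)
    then obtain i where i: "i \<in> f x \<oplus> f y" "f x \<oplus> {i} \<in> f ` verts G"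
      using step[of "f x" "f y"] xy by blast
    then obtain u where u: "u \<in> verts G" "f u = f x \<oplus> {i}" by auto
    moreover have "Suc (card (f u \<oplus> f y)) = card (f x \<oplus> f y)"
      using card_sdiff_flip(1)[OF _ _ i(1)] fin xy u by simp
    ultimately show ?thesis using adj_iff[of x u] xy by (intro bexI[of _ u]) auto
  qed
  obtain u where u: "u \<in> verts G" "adj G v u" using stepG[OF v w(1)] w(2) by metis
  have "y \<in> {v, u}" if y: "y \<in> verts G" for y
  proof (rule ccontr)
    assume n: "y \<notin> {v, u}"
    obtain a where a: "a \<in> verts G" "adj G v a" "card (f a \<oplus> f y) < card (f v \<oplus> f y)"
      using stepG[OF v y] n by blast
    have "a = u" using one[OF v] a u by blast
    obtain b where b: "b \<in> verts G" "adj G u b" "card (f b \<oplus> f y) < card (f u \<oplus> f y)"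
      using stepG[OF u(1) y] n by blast
    \<comment> \<open>With degree at most one, the second step towards \<open>y\<close> can only go
      back, although both steps should come closer to \<open>y\<close>.\<close>
    have "b = v" using one[OF u(1)] b u v adj_commute by metis
    then show False using a b \<open>a = u\<close> by simp
  qed
  then have V: "verts G = {v, u}" using v u by blast
  have "v \<noteq> u" using u irr by blast
  have K2: "adj (complete_graph 2) i j \<longleftrightarrow> i \<noteq> j" if "i < 2" "j < 2" for i j
    using that by (auto simp: complete_graph_def adj_def edges_def doubleton_eq_iff)
  have "isomorphic G (complete_graph 2)"
    unfolding isomorphic_def
  proof (intro exI[of _ "\<lambda>x. if x = v then 0 else 1"] conjI ballI)
    show "bij_betw (\<lambda>x. if x = v then 0 else 1) (verts G) (verts (complete_graph 2))"
      using V \<open>v \<noteq> u\<close> by (auto simp: bij_betw_def complete_graph_def verts_def inj_on_def)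
    fix x y assume "x \<in> verts G" "y \<in> verts G"
    then show "adj G x y \<longleftrightarrow> adj (complete_graph 2) (if x = v then 0 else 1) (if y = v then 0 else 1)"
      using V irr u(2) adj_commute[of G u v] K2 \<open>v \<noteq> u\<close> by auto
  qed
  then show False using assms(4) by blast
qed

end

theorem theorem1p1:
  fixes G :: "'a graph" and n :: nat
  assumes "sgraph G" and "finite (verts G)" and "verts G \<noteq> {}"
    and "regular G" and "partial_cube G"
    and "\<not> isomorphic G (complete_graph 1)" and "\<not> isomorphic G (complete_graph 2)"
    and "n \<ge> 4"
  shows "(\<forall>H. convex_cycle H G \<longrightarrow> is_l_cycle H (2 * n)) \<longleftrightarrow> isomorphic G (cycle_graph (2 * n))"
proof -
  obtain f :: "'a \<Rightarrow> nat set" where "cube_embedding G f"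
    by (rule partial_cube_embedding[OF assms(1,2,5)])
  then interpret cube_embedding G f .
  show ?thesis
  proof
    assume iso: "isomorphic G (cycle_graph (2 * n))"
    show "\<forall>H. convex_cycle H G \<longrightarrow> is_l_cycle H (2 * n)"
    proof (intro allI impI)
      fix H assume "convex_cycle H G"
      then obtain l where l: "is_l_cycle H l" and "subgraph H G"
        by (auto simp: convex_cycle_def is_cycle_def convex_subgraph_def isometric_subgraph_def)
      \<comment> \<open>A cycle graph has degrees at most 2, so each cycle in \<open>G\<close> spans
        it and its length is the number of vertices.\<close>
      then have "verts H = verts G"
        using cycle_subgraph_spanning isomorphic_cycle_degree[OF iso] by blast
      moreover have "card (verts G) = 2 * n"
        using iso bij_betw_same_card unfolding isomorphic_def by (fastforce simp: cycle_graph_def verts_def)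
      ultimately show "is_l_cycle H (2 * n)" using l is_l_cycle_card by metis
    qed
  next
    assume conv: "\<forall>H. convex_cycle H G \<longrightarrow> is_l_cycle H (2 * n)"
    then interpret equal_zones "f ` verts G" n
      using equal_zones_if_convex_cycles assms(8) by blast
    obtain k where k: "\<And>v. v \<in> verts G \<Longrightarrow> card {u \<in> verts G. adj G v u} = k"
      using assms(4) unfolding regular_def by blast
    have k2: "k \<ge> 2" using regular_degree_ge_2[OF k assms(3,6,7)] by blast
    obtain z where z: "z \<in> verts G" using assms(3) by blast
    define d where "d x = card (f x \<oplus> f z)" for x
    obtain x where x: "x \<in> verts G" "\<And>y. y \<in> verts G \<Longrightarrow> d y \<le> d x"
    proof -
      have "Max (d ` verts G) \<in> d ` verts G" using fin_verts assms(3) by (intro Max_in) auto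
      then show thesis using that Max_ge[of "d ` verts G"] fin_verts by fastforce
    qed
    define I where "I = {i. f x \<oplus> {i} \<in> f ` verts G}"
    have cI: "card I = k" using degree[OF x(1)] k[OF x(1)] by (simp add: I_def)
    \<comment> \<open>A flip away from \<open>z\<close> would give a vertex farther from
      \<open>z\<close> than \<open>x\<close>.\<close>
    have down: "i \<in> f x \<oplus> f z" if i: "i \<in> I" for i
    proof (rule ccontr)
      assume n: "i \<notin> f x \<oplus> f z"
      obtain y where y: "y \<in> verts G" "f y = f x \<oplus> {i}" using i by (auto simp: I_def)
      have "d y = Suc (d x)"
        using card_sdiff_flip(2)[OF _ _ n] fin x(1) z y(2) by (simp add: d_def)
      then show False using x(2)[OF y(1)] by simp
    qed
    have "k < 3"
    proof (rule ccontr)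
      assume "\<not> k < 3"
      then obtain T where "T \<subseteq> I" "card T = 3" using cI obtain_subset_with_card_n by (metis not_less)
      then obtain i j l where "i \<in> I" "j \<in> I" "l \<in> I" "i \<noteq> j" "i \<noteq> l" "j \<noteq> l"
        by (auto simp: card_3_iff)
      then show False
        using at_most_two_down[of "f x" "f z" i j l] down x(1) z by (simp add: I_def)
    qed
    then have "card I = 2" using cI k2 by simp
    then obtain i j where ij: "i \<in> I" "j \<in> I" "i \<noteq> j" by (auto simp: card_2_iff)
    have "f x \<in> f ` verts G" "f z \<in> f ` verts G" "f x \<oplus> {i} \<in> f ` verts G" "f x \<oplus> {j} \<in> f ` verts G"
      using x(1) z ij by (auto simp: I_def)
    then obtain ds where ds: "cyc (f x) ds" "length ds = n"
      using cyc_towards[OF _ _ down[OF ij(1)] down[OF ij(2)] ij(3)] by metis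
    let ?W = "subcube (f x) (set ds)"
    have l: "is_l_cycle (induced G ?W) (2 * n)"
      using cyc_is_l_cycle[OF ds(1)] ds(2) assms(8) by simp
    moreover have "subgraph (induced G ?W) G"
      using convex_subcube by (auto simp: convex_subgraph_def isometric_subgraph_def)
    \<comment> \<open>Here regularity is used: the degree \<open>k\<close>, bounded at
      \<open>x\<close>, is that of every vertex.\<close>
    ultimately have "verts (induced G ?W) = verts G"
      by (intro cycle_subgraph_spanning) (use k \<open>k < 3\<close> in auto)
    then have "is_l_cycle G (2 * n)" using l induced_verts[OF assms(1)] by simp
    then show "isomorphic G (cycle_graph (2 * n))" by (rule is_l_cycle_isomorphic)
  qed
qed

end
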